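(* For all integers $r, k \geq 2$, we have $s_r(K_{k+1}) \leq P_r(k)$.
   Context: All graphs are finite and simple. For graphs $G,H$ and an integer $r\ge 1$, write $G \rightarrow (H)_r$ if every colouring of the edges of $G$ with $r$ colours contains a monochromatic copy of $H$. A graph $G$ is $r$-Ramsey-minimal for $H$ if $G \rightarrow (H)_r$ but no proper subgraph $G'\subsetneq G$ satisfies $G' \rightarrow (H)_r$. Define $s_r(H) := \min \delta(G)$ over all graphs $G$ that are $r$-Ramsey-minimal for $H$, where $\delta$ denotes minimum degree. A colour pattern on a vertex set $V$ is a sequence $G_1,\dots,G_r$ of pairwise edge-disjoint graphs all having vertex set $V$; it is $H$-free if no $G_i$ contains $H$ as a subgraph. Given a colour pattern $G_1,\dots,G_r$ on $V$ and a colouring $c: V \to [r]$, a strongly monochromatic $K_k$ is a set of $k$ vertices all receiving the same colour $i$ under $c$ and forming a clique in $G_i$. $P_r(k)$ is the smallest integer $n$ such that there exists a $K_{k+1}$-free colour pattern $G_1,\dots,G_r$ on an $n$-element vertex set $V$ such that every colouring $V \to [r]$ yields a strongly monochromatic $K_k$. *)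

theory Defs
  imports Main "HOL-Library.Extended_Nat"
begin

text \<open>A finite simple graph: a finite vertex set V and a set E of 2-element subsets of V.
  Vertices are natural numbers (every finite graph is isomorphic to one of these).\<close>
definition is_graph :: "nat set \<Rightarrow> nat set set \<Rightarrow> bool" where
  "is_graph V E \<longleftrightarrow> finite V \<and> (\<forall>e\<in>E. e \<subseteq> V \<and> card e = 2)"

definition has_copy :: "nat set \<Rightarrow> nat set set \<Rightarrow> nat set \<Rightarrow> nat set set \<Rightarrow> bool" where
  "has_copy VH EH V E \<longleftrightarrow>
     (\<exists>f. inj_on f VH \<and> f ` VH \<subseteq> V \<and> (\<forall>e\<in>EH. f ` e \<in> E))"

definition K_vert :: "nat \<Rightarrow> nat set" where
  "K_vert n = {0..<n}"

definition K_edges :: "nat \<Rightarrow> nat set set" where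
  "K_edges n = {e. e \<subseteq> {0..<n} \<and> card e = 2}"

definition arrows :: "nat set \<Rightarrow> nat set set \<Rightarrow> nat set \<Rightarrow> nat set set \<Rightarrow> nat \<Rightarrow> bool" where
  "arrows V E VH EH r \<longleftrightarrow>
     (\<forall>c :: nat set \<Rightarrow> nat. (\<forall>e\<in>E. c e < r) \<longrightarrow>
        (\<exists>i<r. has_copy VH EH V {e\<in>E. c e = i}))"

definition ramsey_minimal :: "nat set \<Rightarrow> nat set set \<Rightarrow> nat set \<Rightarrow> nat set set \<Rightarrow> nat \<Rightarrow> bool" where
  "ramsey_minimal V E VH EH r \<longleftrightarrow>
     is_graph V E \<and> arrows V E VH EH r \<and>
     (\<forall>V' E'. is_graph V' E' \<and> V' \<subseteq> V \<and> E' \<subseteq> E \<and> (V', E') \<noteq> (V, E)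
        \<longrightarrow> \<not> arrows V' E' VH EH r)"

definition degree :: "nat set set \<Rightarrow> nat \<Rightarrow> nat" where
  "degree E v = card {e\<in>E. v \<in> e}"

definition min_degree :: "nat set \<Rightarrow> nat set set \<Rightarrow> nat" where
  "min_degree V E = Min (degree E ` V)"

text \<open>s_r(H), valued in enat (infimum of the empty set is \<infinity>).\<close>
definition s_r :: "nat \<Rightarrow> nat set \<Rightarrow> nat set set \<Rightarrow> enat" where
  "s_r r VH EH = (INF G \<in> {(V, E). ramsey_minimal V E VH EH r}. enat (min_degree (fst G) (snd G)))"

definition is_clique :: "nat set set \<Rightarrow> nat set \<Rightarrow> bool" where
  "is_clique E S \<longleftrightarrow> (\<forall>x\<in>S. \<forall>y\<in>S. x \<noteq> y \<longrightarrow> {x, y} \<in> E)"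

definition colour_pattern :: "nat \<Rightarrow> nat set \<Rightarrow> (nat \<Rightarrow> nat set set) \<Rightarrow> bool" where
  "colour_pattern r V Gs \<longleftrightarrow>
     (\<forall>i<r. is_graph V (Gs i)) \<and>
     (\<forall>i<r. \<forall>j<r. i \<noteq> j \<longrightarrow> Gs i \<inter> Gs j = {})"

definition pattern_H_free :: "nat \<Rightarrow> nat set \<Rightarrow> (nat \<Rightarrow> nat set set) \<Rightarrow> nat set \<Rightarrow> nat set set \<Rightarrow> bool" where
  "pattern_H_free r V Gs VH EH \<longleftrightarrow> (\<forall>i<r. \<not> has_copy VH EH V (Gs i))"

definition strongly_mono_clique ::
  "nat \<Rightarrow> nat set \<Rightarrow> (nat \<Rightarrow> nat set set) \<Rightarrow> (nat \<Rightarrow> nat) \<Rightarrow> nat \<Rightarrow> bool" where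
  "strongly_mono_clique r V Gs c k \<longleftrightarrow>
     (\<exists>S i. S \<subseteq> V \<and> card S = k \<and> i < r \<and> (\<forall>v\<in>S. c v = i) \<and> is_clique (Gs i) S)"

text \<open>P_r(k), valued in enat (infimum of the empty set is \<infinity>).\<close>
definition P_r :: "nat \<Rightarrow> nat \<Rightarrow> enat" where
  "P_r r k = Inf {enat n | n. \<exists>V Gs. finite V \<and> card V = n \<and>
      colour_pattern r V Gs \<and> pattern_H_free r V Gs (K_vert (k+1)) (K_edges (k+1)) \<and>
      (\<forall>c :: nat \<Rightarrow> nat. (\<forall>v\<in>V. c v < r) \<longrightarrow> strongly_mono_clique r V Gs c k)}"

end

theory Submission
  imports Defs "HOL-Library.Ramsey" "HOL-Library.Countable"
begin

text \<open>Let a K_{k+1}-free colour pattern on V be given for which every vertex colouring has a strongly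
  monochromatic K_k. Suppose a graph G does not arrow K_{k+1}, but every r-colouring of G without a
  monochromatic K_{k+1} contains a copy of the pattern, up to a permutation of the colours. Join a new
  vertex to each set of card V vertices of G. A colouring of the new graph that leaves G without
  a monochromatic K_{k+1} produces a copy of the pattern, and the edges to the new vertex above it
  colour V, so that a strongly monochromatic K_k is completed to a monochromatic K_{k+1}. Hence the new
  graph arrows K_{k+1}, and a minimal subgraph has to use a new vertex, whose degree is at most card V.

  To find G, regard the pattern as a graph with edges of r types and add, for each two types, a
  K_{k+1} using exactly these two. The partite construction of Nesetril and Rodl, with
  the Hales-Jewett theorem as the partite lemma, yields a typed graph without a K_{k+1} of one type
  such that for every colouring some copy of the given typed graph has the colour of its edges
  determined by the type. The added cliques force different types to have different colours.\<close>

subsection \<open>The Hales--Jewett theorem\<close>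

definition fill :: "'a \<Rightarrow> 'a option list \<Rightarrow> 'a list" where
  "fill a v = map (case_option a id) v"

text \<open>In a variable word, \<^const>\<open>None\<close> is the variable; all its occurrences are filled with the same letter.\<close>
definition variable_word :: "'a set \<Rightarrow> nat \<Rightarrow> 'a option list \<Rightarrow> bool" where
  "variable_word A N v \<longleftrightarrow> length v = N \<and> None \<in> set v \<and> set v \<subseteq> insert None (Some ` A)"

lemma fill_append: "fill a (u @ v) = fill a u @ fill a v"
  by (simp add: fill_def)

lemma fill_map_Some [simp]: "fill a (map Some w) = w"
  by (simp add: fill_def map_idI)

lemma set_fill_subset:
  assumes "variable_word A N v" "a \<in> B" "A \<subseteq> B"
  shows "set (fill a v) \<subseteq> B"
  using assms by (fastforce simp: fill_def variable_word_def split: option.splits)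

lemma variable_word_append:
  assumes "variable_word A M u" "variable_word A N v"
  shows "variable_word A (M + N) (u @ v)"
  using assms by (auto simp: variable_word_def)

lemma variable_word_append_const:
  assumes "variable_word A M u" "length w = N" "set w \<subseteq> A"
  shows "variable_word A (M + N) (u @ map Some w)"
  using assms by (auto simp: variable_word_def)

lemma variable_word_const_append:
  assumes "variable_word A N v" "length w = M" "set w \<subseteq> A"
  shows "variable_word A (M + N) (map Some w @ v)"
  using assms by (auto simp: variable_word_def)

lemma variable_word_mono:
  "variable_word A N v \<Longrightarrow> A \<subseteq> B \<Longrightarrow> variable_word B N v"
  unfolding variable_word_def by blast

lemma length_fill [simp]: "length (fill a v) = length v"
  by (simp add: fill_def)

definition mono_line :: "'a set \<Rightarrow> nat \<Rightarrow> ('a list \<Rightarrow> 'c) \<Rightarrow> bool" where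
  "mono_line A N c \<longleftrightarrow> (\<exists>v j. variable_word A N v \<and> (\<forall>a\<in>A. c (fill a v) = j))"

text \<open>An injection of \<open>K\<close> into the naturals carries the statement over. It is
  wanted for colours that are themselves lists of colours, as they arise in colour focusing.\<close>

lemma mono_line_finite_colours:
  fixes K :: "'c set"
  assumes "\<And>r. \<exists>N. \<forall>c :: 'a list \<Rightarrow> nat. (\<forall>w. c w < r) \<longrightarrow> mono_line A N c" and "finite K"
  shows "\<exists>N. \<forall>c :: 'a list \<Rightarrow> 'c. (\<forall>w. c w \<in> K) \<longrightarrow> mono_line A N c"
proof -
  obtain h :: "'c \<Rightarrow> nat" and r where h: "h ` K = {i. i < r}" "inj_on h K"
    using finite_imp_inj_to_nat_seg[OF \<open>finite K\<close>] by blast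
  obtain N where N: "\<forall>c :: 'a list \<Rightarrow> nat. (\<forall>w. c w < r) \<longrightarrow> mono_line A N c"
    using assms(1) by blast
  have "mono_line A N c" if "\<forall>w. c w \<in> K" for c :: "'a list \<Rightarrow> 'c"
  proof -
    have "mono_line A N (h \<circ> c)"
      using N that h(1) by (metis comp_apply imageI mem_Collect_eq)
    then obtain v j where v: "variable_word A N v" "\<forall>a\<in>A. h (c (fill a v)) = j"
      by (auto simp: mono_line_def)
    have "c (fill a v) = c (fill b v)" if "a \<in> A" "b \<in> A" for a b
      using v(2) h(2) that \<open>\<forall>w. c w \<in> K\<close> by (metis inj_onD)
    then show ?thesis
      unfolding mono_line_def using v(1) by (metis (full_types))
  qed
  then show ?thesis by blast
qed

text \<open>The lines indexed by C all pass through the word f when the variable is set to a, and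
  carry pairwise distinct colours on A. If f itself has one of these colours, that line extends
  to a monochromatic line over \<^term>\<open>insert a A\<close>; so C cannot exhaust the colours.\<close>
definition focused :: "'a set \<Rightarrow> 'a \<Rightarrow> nat \<Rightarrow> ('a list \<Rightarrow> nat) \<Rightarrow> nat set \<Rightarrow> 'a list \<Rightarrow> bool" where
  "focused A a N c C f \<longleftrightarrow> length f = N \<and> set f \<subseteq> insert a A \<and>
     (\<forall>j\<in>C. \<exists>v. variable_word (insert a A) N v \<and> fill a v = f \<and> (\<forall>x\<in>A. c (fill x v) = j))"

text \<open>Colour focusing, by induction on the number \<open>m\<close> of lines. Words are split
  into a prefix and a suffix. Hales-Jewett over \<open>A\<close> yields a line of prefixes that no
  suffix can tell apart by colour, and the induction hypothesis gives \<open>m\<close> focused lines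
  of suffixes. Either the focus repeats one of their colours, which closes a monochromatic line, or
  its colour is new and one more line is gained.\<close>

lemma focused_lines:
  fixes A :: "'a set" and r :: nat
  assumes HJ: "\<And>r. \<exists>N. \<forall>c :: 'a list \<Rightarrow> nat. (\<forall>w. c w < r) \<longrightarrow> mono_line A N c"
    and A: "finite A" "A \<noteq> {}"
  shows "\<exists>N. \<forall>c. (\<forall>w. c w < r) \<longrightarrow> mono_line (insert a A) N c \<or>
           (\<exists>C f. card C = m \<and> C \<subseteq> {..<r} \<and> focused A a N c C f)"
proof (induction m)
  case 0
  show ?case
    by (rule exI[of _ 0]) (auto simp: focused_def intro!: exI[of _ "{}"])
next
  case (Suc m)
  obtain a0 where a0: "a0 \<in> A" using A by blast
  obtain N where N: "\<And>c. (\<And>w. c w < r) \<Longrightarrow> mono_line (insert a A) N c \<or>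
           (\<exists>C f. card C = m \<and> C \<subseteq> {..<r} \<and> focused A a N c C f)"
    using Suc.IH by blast
  define W where "W = {w. set w \<subseteq> insert a A \<and> length w = N}"
  have finW: "finite W"
    unfolding W_def using A by (intro finite_lists_length_eq) auto
  then obtain ws where ws: "set ws = W" using finite_list by blast
  \<comment> \<open>A prefix is coloured by the list of the colours of all its extensions by words
    in \<open>W\<close>; \<open>K\<close> contains all such lists.\<close>
  define K where "K = {u :: nat list. set u \<subseteq> {..<r} \<and> length u = length ws}"
  have "finite K"
    unfolding K_def by (intro finite_lists_length_eq) auto
  then obtain M where M: "\<And>c :: 'a list \<Rightarrow> nat list. (\<And>w. c w \<in> K) \<Longrightarrow> mono_line A M c"
    using mono_line_finite_colours[OF HJ] by blast
  have "mono_line (insert a A) (M + N) c \<or>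
           (\<exists>C f. card C = Suc m \<and> C \<subseteq> {..<r} \<and> focused A a (M + N) c C f)"
    if c: "\<And>w. c w < r" for c
  proof -
    have "mono_line A M (\<lambda>u. map (\<lambda>w. c (u @ w)) ws)"
      by (rule M) (auto simp: K_def c)
    then obtain u j where u: "variable_word A M u" "\<forall>x\<in>A. map (\<lambda>w. c (fill x u @ w)) ws = j"
      by (auto simp: mono_line_def)
    have u': "variable_word (insert a A) M u"
      using u(1) by (rule variable_word_mono) auto
    have eq: "c (fill x u @ w) = c (fill a0 u @ w)" if "x \<in> A" "w \<in> W" for x w
      using u(2) that a0 ws by (metis (mono_tags, lifting) map_eq_conv)
    have u0: "length (fill a0 u) = M" "set (fill a0 u) \<subseteq> insert a A"
      using u(1) a0 set_fill_subset[OF u(1), of a0 "insert a A"]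
      by (auto simp: variable_word_def)
    \<comment> \<open>By \<open>eq\<close> the prefix filled with \<open>a0\<close> represents the
      prefixes filled with any letter of \<open>A\<close>. The letter \<open>a\<close> is not
      covered, and this is where the new focus comes from.\<close>
    let ?c = "\<lambda>w. c (fill a0 u @ w)"
    from N[of ?c] c consider (1) "mono_line (insert a A) N ?c"
      | (2) C f where "card C = m" "C \<subseteq> {..<r}" "focused A a N ?c C f"
      by blast
    then show ?thesis
    proof cases
      case 1
      then obtain v j where v: "variable_word (insert a A) N v" "\<forall>x\<in>insert a A. ?c (fill x v) = j"
        unfolding mono_line_def by blast
      have "variable_word (insert a A) (M + N) (map Some (fill a0 u) @ v)"
        by (rule variable_word_const_append[OF v(1) u0])
      moreover have "\<forall>x\<in>insert a A. c (fill x (map Some (fill a0 u) @ v)) = j"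
        using v(2) by (simp add: fill_append)
      ultimately show ?thesis unfolding mono_line_def by blast
    next
      case 2
      have f: "length f = N" "set f \<subseteq> insert a A" "f \<in> W"
        using 2(3) by (auto simp: focused_def W_def)
      have lines: "\<exists>v. variable_word (insert a A) N v \<and> fill a v = f \<and> (\<forall>x\<in>A. ?c (fill x v) = j)"
        if "j \<in> C" for j
        using 2(3) that by (auto simp: focused_def)
      define j0 where "j0 = ?c f"
      show ?thesis
      proof (cases "j0 \<in> C")
        case True
        then obtain v where v: "variable_word (insert a A) N v" "fill a v = f"
            "\<forall>x\<in>A. ?c (fill x v) = j0"
          using lines by blast
        have "variable_word (insert a A) (M + N) (map Some (fill a0 u) @ v)"
          by (rule variable_word_const_append[OF v(1) u0])
        moreover have "\<forall>x\<in>insert a A. c (fill x (map Some (fill a0 u) @ v)) = j0"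
          using v(2,3) by (auto simp: fill_append j0_def)
        ultimately show ?thesis unfolding mono_line_def by blast
      next
        case False
        have "finite C" using 2(2) finite_subset by blast
        then have "card (insert j0 C) = Suc m" using False 2(1) by simp
        moreover have "insert j0 C \<subseteq> {..<r}" using 2(2) c by (auto simp: j0_def)
        moreover have "focused A a (M + N) c (insert j0 C) (fill a u @ f)"
        proof -
          have "length (fill a u @ f) = M + N" "set (fill a u @ f) \<subseteq> insert a A"
            using f u(1) set_fill_subset[OF u', of a "insert a A"]
            by (auto simp: variable_word_def)
          moreover have "\<exists>v. variable_word (insert a A) (M + N) v \<and> fill a v = fill a u @ f \<and>
              (\<forall>x\<in>A. c (fill x v) = j)" if j: "j \<in> insert j0 C" for j
          proof (cases "j = j0")
            case True
            \<comment> \<open>The additional line: the variable occurs only in the prefix. Letters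
              of \<open>A\<close> give the colour \<open>j0\<close> by \<open>eq\<close>, and
              \<open>a\<close> leads to the new focus.\<close>
            show ?thesis
              using variable_word_append_const[OF u' f(1,2)] eq[OF _ f(3)] True
              by (intro exI[of _ "u @ map Some f"]) (simp add: fill_append j0_def)
          next
            case False
            with j lines obtain v where v: "variable_word (insert a A) N v" "fill a v = f"
              "\<forall>x\<in>A. ?c (fill x v) = j" by blast
            \<comment> \<open>An old line is prolonged by letting the variable run in prefix and
              suffix at once, so that \<open>a\<close> leads to the new focus; by \<open>eq\<close>
              its colour on \<open>A\<close> is unchanged.\<close>
            have "fill x v \<in> W" if "x \<in> A" for x
              using v(1) that set_fill_subset[OF v(1), of x "insert a A"]
              by (auto simp: W_def variable_word_def)
            then show ?thesis
              using variable_word_append[OF u' v(1)] eq v(2,3)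
              by (intro exI[of _ "u @ v"]) (simp add: fill_append)
          qed
          ultimately show ?thesis unfolding focused_def by blast
        qed
        ultimately show ?thesis by blast
      qed
    qed
  qed
  then show ?case by blast
qed

theorem hales_jewett:
  fixes A :: "'a set"
  assumes "finite A"
  shows "\<exists>N. \<forall>c :: 'a list \<Rightarrow> nat. (\<forall>w. c w < r) \<longrightarrow> mono_line A N c"
  using assms
proof (induction A arbitrary: r)
  case empty
  show ?case
    by (intro exI[of _ 1]) (auto simp: mono_line_def variable_word_def intro!: exI[of _ "[None]"])
next
  case (insert a A)
  show ?case
  proof (cases "A = {}")
    \<comment> \<open>Over a one-letter alphabet every variable word is monochromatic. Colour
      focusing starts from a nonempty \<open>A\<close>.\<close>
    case True
    then show ?thesis
      by (intro exI[of _ 1]) (auto simp: mono_line_def variable_word_def intro!: exI[of _ "[None]"])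
  next
    case False
    obtain N where N: "\<And>c. (\<And>w. c w < r) \<Longrightarrow> mono_line (insert a A) N c \<or>
           (\<exists>C f. card C = Suc r \<and> C \<subseteq> {..<r} \<and> focused A a N c C f)"
      using focused_lines[OF insert.IH insert.hyps(1) False, of r a "Suc r"] by blast
    \<comment> \<open>There are no \<open>r + 1\<close> colours below \<open>r\<close>, so only the
      monochromatic line remains.\<close>
    have "\<not> (card C = Suc r \<and> C \<subseteq> {..<r})" for C :: "nat set"
      using card_mono[of "{..<r}" C] by auto
    with N show ?thesis by blast
  qed
qed

subsection \<open>Typed graphs and gluing\<close>

definition type_clique :: "(nat \<Rightarrow> nat \<Rightarrow> nat option) \<Rightarrow> nat \<Rightarrow> nat set \<Rightarrow> bool" where
  "type_clique T s S \<longleftrightarrow> (\<forall>x\<in>S. \<forall>y\<in>S. x \<noteq> y \<longrightarrow> T x y = Some s)"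

text \<open>An edge xy of type s is encoded as \<open>T x y = Some s\<close>, which makes the types edge-disjoint;
  no type may contain a clique on q vertices.\<close>
definition typed_graph :: "nat \<Rightarrow> nat \<Rightarrow> nat set \<Rightarrow> (nat \<Rightarrow> nat \<Rightarrow> nat option) \<Rightarrow> bool" where
  "typed_graph q r V T \<longleftrightarrow> finite V \<and> (\<forall>x y. T x y = T y x) \<and>
     (\<forall>x y s. T x y = Some s \<longrightarrow> x \<in> V \<and> y \<in> V \<and> x \<noteq> y \<and> s < r) \<and>
     (\<forall>S s. S \<subseteq> V \<and> card S = q \<longrightarrow> \<not> type_clique T s S)"

definition embeds :: "(nat \<Rightarrow> nat) \<Rightarrow> nat set \<Rightarrow> (nat \<Rightarrow> nat \<Rightarrow> nat option) \<Rightarrow>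
    nat set \<Rightarrow> (nat \<Rightarrow> nat \<Rightarrow> nat option) \<Rightarrow> bool" where
  "embeds f V T V' T' \<longleftrightarrow> inj_on f V \<and> f ` V \<subseteq> V' \<and>
     (\<forall>x y s. T x y = Some s \<longrightarrow> T' (f x) (f y) = Some s)"

lemma typed_graphD:
  assumes "typed_graph q r V T"
  shows "finite V" "T x y = T y x"
    "T x y = Some s \<Longrightarrow> x \<in> V" "T x y = Some s \<Longrightarrow> y \<in> V" "T x y = Some s \<Longrightarrow> x \<noteq> y" "T x y = Some s \<Longrightarrow> s < r"
    "S \<subseteq> V \<Longrightarrow> card S = q \<Longrightarrow> \<not> type_clique T s S"
  using assms unfolding typed_graph_def by blast+

lemma embeds_trans:
  assumes "embeds f U T V T'" "embeds g V T' W T''"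
  shows "embeds (g \<circ> f) U T W T''"
proof -
  have "inj_on (g \<circ> f) U"
    using assms by (auto simp: embeds_def intro: comp_inj_on inj_on_subset)
  then show ?thesis
    using assms by (fastforce simp: embeds_def)
qed

definition glue_rel :: "'i set \<Rightarrow> ('i \<Rightarrow> nat \<Rightarrow> nat) \<Rightarrow> ('i \<Rightarrow> nat \<Rightarrow> nat \<Rightarrow> nat option) \<Rightarrow> nat \<Rightarrow> nat \<Rightarrow> nat \<Rightarrow> bool" where
  "glue_rel I \<psi> T u w s \<longleftrightarrow> (\<exists>i\<in>I. \<exists>x y. u = \<psi> i x \<and> w = \<psi> i y \<and> T i x y = Some s)"

text \<open>Images of different pieces may overlap. The choice of a type becomes unambiguous under
  the condition \<open>compat\<close> below.\<close>

definition glue :: "'i set \<Rightarrow> ('i \<Rightarrow> nat \<Rightarrow> nat) \<Rightarrow> ('i \<Rightarrow> nat \<Rightarrow> nat \<Rightarrow> nat option) \<Rightarrow> nat \<Rightarrow> nat \<Rightarrow> nat option" where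
  "glue I \<psi> T u w =
     (if \<exists>s. glue_rel I \<psi> T u w s then Some (SOME s. glue_rel I \<psi> T u w s) else None)"

lemma glue_SomeD:
  assumes "glue I \<psi> T u w = Some s"
  obtains i x y where "i \<in> I" "u = \<psi> i x" "w = \<psi> i y" "T i x y = Some s"
proof -
  have "glue_rel I \<psi> T u w s"
    using assms someI_ex[of "glue_rel I \<psi> T u w"] unfolding glue_def by (auto split: if_splits)
  then show thesis using that unfolding glue_rel_def by blast
qed

lemma glue_Some_exI:
  assumes "i \<in> I" "T i x y = Some s"
  shows "\<exists>s. glue I \<psi> T (\<psi> i x) (\<psi> i y) = Some s"
proof -
  have "glue_rel I \<psi> T (\<psi> i x) (\<psi> i y) s" using assms unfolding glue_rel_def by blast
  then show ?thesis unfolding glue_def by auto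
qed

text \<open>Conditions for amalgamating typed graphs: \<open>compat\<close> makes the pieces agree,
  on edges and non-edges alike, wherever their images overlap, and \<open>clique_in_piece\<close>
  prevents a clique of one type from being assembled out of several pieces.\<close>

locale gluing =
  fixes q r :: nat and I :: "'i set" and V :: "'i \<Rightarrow> nat set"
    and T :: "'i \<Rightarrow> nat \<Rightarrow> nat \<Rightarrow> nat option" and \<psi> :: "'i \<Rightarrow> nat \<Rightarrow> nat"
  assumes finI: "finite I"
    and typed: "i \<in> I \<Longrightarrow> typed_graph q r (V i) (T i)"
    and inj: "i \<in> I \<Longrightarrow> inj_on (\<psi> i) (V i)"
    and compat: "\<lbrakk>i \<in> I; j \<in> I; T i x y = Some s; x' \<in> V j; y' \<in> V j; \<psi> i x = \<psi> j x'; \<psi> i y = \<psi> j y'\<rbrakk>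
      \<Longrightarrow> T j x' y' = Some s"
    and clique_in_piece: "\<lbrakk>S \<subseteq> (\<Union>i\<in>I. \<psi> i ` V i); card S = q; type_clique (glue I \<psi> T) s S\<rbrakk>
      \<Longrightarrow> \<exists>i\<in>I. S \<subseteq> \<psi> i ` V i"
begin

lemma glue_image:
  assumes "i \<in> I" "x \<in> V i" "y \<in> V i"
  shows "glue I \<psi> T (\<psi> i x) (\<psi> i y) = T i x y"
proof (cases "T i x y")
  case None
  have False if "glue I \<psi> T (\<psi> i x) (\<psi> i y) = Some s" for s
    using that compat[OF _ assms(1) _ assms(2,3)] None by (metis glue_SomeD option.distinct(1))
  then show ?thesis using None by fastforce
next
  case (Some s)
  then obtain s' where s': "glue I \<psi> T (\<psi> i x) (\<psi> i y) = Some s'"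
    using glue_Some_exI[of i I T x y s \<psi>] assms(1) by blast
  then have "T i x y = Some s'"
    using compat[OF _ assms(1) _ assms(2,3)] by (metis glue_SomeD)
  then show ?thesis using s' by simp
qed

lemma embeds_glue:
  assumes i: "i \<in> I"
  shows "embeds (\<psi> i) (V i) (T i) (\<Union>i\<in>I. \<psi> i ` V i) (glue I \<psi> T)"
  unfolding embeds_def
proof (intro conjI allI impI)
  show "inj_on (\<psi> i) (V i)" by (rule inj[OF i])
  show "\<psi> i ` V i \<subseteq> (\<Union>i\<in>I. \<psi> i ` V i)" using i by blast
  show "glue I \<psi> T (\<psi> i x) (\<psi> i y) = Some s" if "T i x y = Some s" for x y s
    using glue_image[OF i] typed_graphD(3,4)[OF typed[OF i] that] that by simp
qed

lemma glue_sym: "glue I \<psi> T u w = glue I \<psi> T w u"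
proof -
  have "T i x y = T i y x" if "i \<in> I" for i x y by (rule typed_graphD(2)[OF typed[OF that]])
  then have "glue_rel I \<psi> T u w s = glue_rel I \<psi> T w u s" for s
    unfolding glue_rel_def by metis
  then show ?thesis unfolding glue_def by presburger
qed

lemma typed_graph_glue: "typed_graph q r (\<Union>i\<in>I. \<psi> i ` V i) (glue I \<psi> T)"
  unfolding typed_graph_def
proof (intro conjI allI impI)
  show "finite (\<Union>i\<in>I. \<psi> i ` V i)" using finI typed_graphD(1)[OF typed] by blast
  show "glue I \<psi> T u w = glue I \<psi> T w u" for u w by (rule glue_sym)
  fix u w s assume "glue I \<psi> T u w = Some s"
  then obtain i x y where i: "i \<in> I" "u = \<psi> i x" "w = \<psi> i y" "T i x y = Some s"
    by (rule glue_SomeD)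
  note ends = typed_graphD(3-6)[OF typed[OF i(1)] i(4)]
  show "u \<in> (\<Union>i\<in>I. \<psi> i ` V i)" using i ends(1) by blast
  show "w \<in> (\<Union>i\<in>I. \<psi> i ` V i)" using i ends(2) by blast
  show "s < r" by (rule ends(4))
  show "u \<noteq> w" unfolding i(2,3) using inj_on_eq_iff[OF inj[OF i(1)] ends(1,2)] ends(3) by simp
next
  fix S s assume S: "S \<subseteq> (\<Union>i\<in>I. \<psi> i ` V i) \<and> card S = q"
  show "\<not> type_clique (glue I \<psi> T) s S"
  proof
    assume cl: "type_clique (glue I \<psi> T) s S"
    then obtain i where i: "i \<in> I" "S \<subseteq> \<psi> i ` V i" using clique_in_piece[OF _ _ cl] S by auto
    \<comment> \<open>Pulled back to the piece that contains it, the clique contradicts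
      \<open>typed\<close>.\<close>
    define S0 where "S0 = {x \<in> V i. \<psi> i x \<in> S}"
    have im: "\<psi> i ` S0 = S" using i(2) by (auto simp: S0_def)
    have inj0: "inj_on (\<psi> i) S0" using inj[OF i(1)] by (rule inj_on_subset) (auto simp: S0_def)
    have "card S0 = q" using card_image[OF inj0] im S by simp
    moreover have "type_clique (T i) s S0"
      unfolding type_clique_def
    proof (intro ballI impI)
      fix x y assume xy: "x \<in> S0" "y \<in> S0" "x \<noteq> y"
      then have "\<psi> i x \<noteq> \<psi> i y" using inj0 by (meson inj_onD)
      then have "glue I \<psi> T (\<psi> i x) (\<psi> i y) = Some s"
        using cl xy by (auto simp: type_clique_def S0_def)
      then show "T i x y = Some s" using glue_image[OF i(1)] xy by (simp add: S0_def)
    qed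
    ultimately show False
      using typed_graphD(7)[OF typed[OF i(1)], of S0 s] by (auto simp: S0_def)
  qed
qed

end

text \<open>Adjacency never leaves a piece, so a nonempty clique lies in the piece of any one of its
  vertices.\<close>

lemma disjoint_union_gluing:
  fixes I :: "'i :: countable set"
  assumes "finite I" "\<And>i. i \<in> I \<Longrightarrow> typed_graph q r (V i) (T i)" "q > 0"
  shows "gluing q r I V T (\<lambda>i x. to_nat (i, x))"
proof
  fix S s assume S: "S \<subseteq> (\<Union>i\<in>I. (\<lambda>x. to_nat (i, x)) ` V i)" "card S = q"
    and cl: "type_clique (glue I (\<lambda>i x. to_nat (i, x)) T) s S"
  obtain u where u: "u \<in> S" using S(2) assms(3) by (metis card.empty ex_in_conv less_irrefl)
  then obtain i x where ix: "i \<in> I" "x \<in> V i" "u = to_nat (i, x)" using S(1) by blast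
  have "w \<in> (\<lambda>x. to_nat (i, x)) ` V i" if "w \<in> S" for w
  proof (cases "w = u")
    case False
    then have "glue I (\<lambda>i x. to_nat (i, x)) T u w = Some s"
      using cl u that by (auto simp: type_clique_def)
    then obtain j x' y' where "j \<in> I" "u = to_nat (j, x')" "w = to_nat (j, y')" "T j x' y' = Some s"
      by (rule glue_SomeD)
    then show ?thesis using ix typed_graphD(4)[OF assms(2)] by auto
  qed (use ix in auto)
  then show "\<exists>i\<in>I. S \<subseteq> (\<lambda>x. to_nat (i, x)) ` V i" using ix(1) by blast
qed (use assms in \<open>auto intro!: inj_onI\<close>)

subsection \<open>The partite construction\<close>

definition partite :: "(nat \<Rightarrow> nat) \<Rightarrow> (nat \<Rightarrow> nat \<Rightarrow> nat option) \<Rightarrow> bool" where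
  "partite \<pi> T \<longleftrightarrow> (\<forall>x y. T x y \<noteq> None \<longrightarrow> \<pi> x \<noteq> \<pi> y)"

text \<open>One copy of the vertex set for each variable word v in the edges of type t between the parts
  a and b. Filling v with such an edge e gives a word of edges, and the two words of endpoints are
  the images of the endpoints of e. Vertices of other parts are never shared between copies.\<close>
definition copy_map :: "(nat \<Rightarrow> nat) \<Rightarrow> nat \<Rightarrow> nat \<Rightarrow> (nat \<times> nat) option list \<Rightarrow> nat \<Rightarrow> nat" where
  "copy_map \<pi> a b v x = to_nat
     (if \<pi> x = a then Inl (map (case_option x fst) v)
      else if \<pi> x = b then Inl (map (case_option x snd) v)
      else Inr (v, x) :: nat list + (nat \<times> nat) option list \<times> nat)"

text \<open>All letters of a word produced by \<open>copy_map\<close> from a variable word over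
  \<open>part_edges\<close> lie in the same part, so the first letter tells the part.\<close>

definition copy_part :: "(nat \<Rightarrow> nat) \<Rightarrow> nat \<Rightarrow> nat" where
  "copy_part \<pi> u = (case from_nat u :: nat list + (nat \<times> nat) option list \<times> nat of
     Inl l \<Rightarrow> \<pi> (hd l) | Inr (v, x) \<Rightarrow> \<pi> x)"

definition part_edges :: "(nat \<Rightarrow> nat) \<Rightarrow> (nat \<Rightarrow> nat \<Rightarrow> nat option) \<Rightarrow> nat \<Rightarrow> nat \<Rightarrow> nat \<Rightarrow> (nat \<times> nat) set" where
  "part_edges \<pi> T t a b = {(x, y). T x y = Some t \<and> \<pi> x = a \<and> \<pi> y = b}"

lemma copy_part_copy_map:
  assumes v: "variable_word (part_edges \<pi> T t a b) N v"
  shows "copy_part \<pi> (copy_map \<pi> a b v x) = \<pi> x"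
proof -
  have "v \<noteq> []" using v by (auto simp: variable_word_def)
  then have hd: "hd (map f v) = f (hd v)" "hd v \<in> set v" for f :: "_ \<Rightarrow> nat"
    by (simp_all add: hd_map)
  then have "hd v = None \<or> hd v \<in> Some ` part_edges \<pi> T t a b"
    using v unfolding variable_word_def by blast
  then show ?thesis
    unfolding copy_part_def copy_map_def
    by (auto simp: hd(1) part_edges_def)
qed

text \<open>This describes how two copies can overlap: in the parts \<open>a\<close> and
  \<open>b\<close> equal images are equal words, to be compared position by position, while a vertex
  of any other part carries its copy in its code.\<close>

lemma copy_map_eqD:
  assumes v: "variable_word (part_edges \<pi> T t a b) N v" and w: "variable_word (part_edges \<pi> T t a b) N w"
    and eq: "copy_map \<pi> a b v x = copy_map \<pi> a b w x'"
  shows "\<pi> x' = \<pi> x"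
    and "\<pi> x = a \<Longrightarrow> i < N \<Longrightarrow> case_option x fst (v ! i) = case_option x' fst (w ! i)"
    and "\<pi> x = b \<Longrightarrow> a \<noteq> b \<Longrightarrow> i < N \<Longrightarrow> case_option x snd (v ! i) = case_option x' snd (w ! i)"
    and "\<pi> x \<noteq> a \<Longrightarrow> \<pi> x \<noteq> b \<Longrightarrow> w = v \<and> x' = x"
proof -
  show part: "\<pi> x' = \<pi> x"
    using copy_part_copy_map[OF v, of x] copy_part_copy_map[OF w, of x'] eq by simp
  have len: "length v = N" "length w = N" using v w by (auto simp: variable_word_def)
  show "\<pi> x \<noteq> a \<Longrightarrow> \<pi> x \<noteq> b \<Longrightarrow> w = v \<and> x' = x"
    using eq part by (auto simp: copy_map_def)
  show "case_option x fst (v ! i) = case_option x' fst (w ! i)" if "\<pi> x = a" "i < N"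
  proof -
    have "map (case_option x fst) v = map (case_option x' fst) w"
      using eq part that by (auto simp: copy_map_def)
    then show ?thesis using len that by (metis nth_map)
  qed
  show "case_option x snd (v ! i) = case_option x' snd (w ! i)" if "\<pi> x = b" "a \<noteq> b" "i < N"
  proof -
    have "map (case_option x snd) v = map (case_option x' snd) w"
      using eq part that by (auto simp: copy_map_def)
    then show ?thesis using len that by (metis nth_map)
  qed
qed

lemma variable_word_None:
  assumes "variable_word A N v"
  obtains i where "i < N" "v ! i = None"
  using assms by (auto simp: variable_word_def in_set_conv_nth)

lemma variable_word_nth_Some:
  assumes "variable_word A N v" "i < N" "v ! i = Some e"
  shows "e \<in> A"
proof -
  have "Some e \<in> set v" using assms by (metis nth_mem variable_word_def)
  then show ?thesis using assms(1) by (auto simp: variable_word_def)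
qed

text \<open>At a position where w has its variable, (x', y') is either (x, y) or a letter of v, hence an
  edge of type t; at a variable of v the roles are exchanged. So either the two pairs agree or both
  are of type t.\<close>
lemma copy_map_compat:
  assumes v: "variable_word (part_edges \<pi> T t a b) N v" and w: "variable_word (part_edges \<pi> T t a b) N w"
    and "a \<noteq> b" and xy: "T x y = Some s" "\<pi> x = a" "\<pi> y = b"
    and eq: "copy_map \<pi> a b v x = copy_map \<pi> a b w x'" "copy_map \<pi> a b v y = copy_map \<pi> a b w y'"
  shows "T x' y' = Some s"
proof -
  note ex = copy_map_eqD(2)[OF v w eq(1) xy(2)]
  note ey = copy_map_eqD(3)[OF v w eq(2) xy(3) \<open>a \<noteq> b\<close>]
  obtain i where i: "i < N" "w ! i = None" using w by (rule variable_word_None)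
  obtain j where j: "j < N" "v ! j = None" using v by (rule variable_word_None)
  show ?thesis
  proof (cases "v ! i")
    case None
    then show ?thesis using ex[OF i(1)] ey[OF i(1)] i(2) xy by simp
  next
    case (Some e)
    then have e: "e = (x', y')" using ex[OF i(1)] ey[OF i(1)] i(2) by auto
    have t: "T x' y' = Some t"
      using variable_word_nth_Some[OF v i(1) Some] by (auto simp: e part_edges_def)
    show ?thesis
    proof (cases "w ! j")
      case None
      then show ?thesis using ex[OF j(1)] ey[OF j(1)] j(2) xy by simp
    next
      case (Some e')
      then have e': "e' = (x, y)" using ex[OF j(1)] ey[OF j(1)] j(2) by auto
      have "T x y = Some t"
        using variable_word_nth_Some[OF w j(1) Some] by (auto simp: e' part_edges_def)
      then show ?thesis using t xy by simp
    qed
  qed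
qed

text \<open>The word of a vertex in part \<open>a\<close> or \<open>b\<close> shows that vertex
  itself wherever \<open>v\<close> has its variable.\<close>

lemma copy_map_inj:
  assumes v: "variable_word (part_edges \<pi> T t a b) N v" and "a \<noteq> b"
    and eq: "copy_map \<pi> a b v x = copy_map \<pi> a b v y"
  shows "x = y"
proof -
  obtain i where i: "i < N" "v ! i = None" using v by (rule variable_word_None)
  show ?thesis
  proof (cases "\<pi> x = a \<or> \<pi> x = b")
    case True
    then show ?thesis
      using copy_map_eqD(2)[OF v v eq _ i(1)] copy_map_eqD(3)[OF v v eq _ \<open>a \<noteq> b\<close> i(1)] i(2) by auto
  next
    case False
    then show ?thesis using copy_map_eqD(4)[OF v v eq] by simp
  qed
qed

text \<open>Edges between the parts \<open>a\<close> and \<open>b\<close> are compatible by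
  \<open>copy_map_compat\<close>; any other edge has an endpoint outside these parts, which
  determines the copy. A clique meets every part at most once, so one with at least three vertices
  has a vertex outside \<open>a\<close> and \<open>b\<close>, and all neighbours of that vertex lie
  in its copy.\<close>

lemma copy_map_gluing:
  assumes G: "typed_graph q r V T" and "q \<ge> 3" and pi: "partite \<pi> T" and "a \<noteq> b"
    and L: "L = {v. variable_word (part_edges \<pi> T t a b) N v}"
  shows "gluing q r L (\<lambda>_. V) (\<lambda>_. T) (copy_map \<pi> a b)"
    and "partite (copy_part \<pi>) (glue L (copy_map \<pi> a b) (\<lambda>_. T))"
proof -
  let ?A = "part_edges \<pi> T t a b"
  let ?glue = "glue L (copy_map \<pi> a b) (\<lambda>_. T)"
  have "?A \<subseteq> V \<times> V" using typed_graphD[OF G] by (auto simp: part_edges_def)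
  then have "finite ?A" using typed_graphD(1)[OF G] by (meson finite_SigmaI finite_subset)
  then have finL: "finite L"
    unfolding L variable_word_def
    by (intro finite_subset[OF _ finite_lists_length_eq[of "insert None (Some ` ?A)" N]]) auto
  show parts: "partite (copy_part \<pi>) ?glue"
    unfolding partite_def
  proof (intro allI impI)
    fix u w assume "?glue u w \<noteq> None"
    then obtain s where "?glue u w = Some s" by blast
    then obtain v x y where v: "v \<in> L" "u = copy_map \<pi> a b v x" "w = copy_map \<pi> a b v y" "T x y = Some s"
      by (rule glue_SomeD)
    then show "copy_part \<pi> u \<noteq> copy_part \<pi> w"
      using pi copy_part_copy_map[of \<pi> T t a b N v] by (auto simp: L partite_def)
  qed
  show "gluing q r L (\<lambda>_. V) (\<lambda>_. T) (copy_map \<pi> a b)"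
  proof
    show "inj_on (copy_map \<pi> a b v) V" if "v \<in> L" for v
      using copy_map_inj[OF _ \<open>a \<noteq> b\<close>] that by (auto simp: L intro!: inj_onI)
  next
    fix v w x y s x' y'
    assume "v \<in> L" "w \<in> L" and T: "T x y = Some s" and "x' \<in> V" "y' \<in> V"
      and eq: "copy_map \<pi> a b v x = copy_map \<pi> a b w x'" "copy_map \<pi> a b v y = copy_map \<pi> a b w y'"
    then have vw: "variable_word ?A N v" "variable_word ?A N w" by (auto simp: L)
    have T': "T y x = Some s" using T typed_graphD(2)[OF G] by metis
    have ne: "\<pi> x \<noteq> \<pi> y" using T pi by (auto simp: partite_def)
    consider "\<pi> x = a" "\<pi> y = b" | "\<pi> x = b" "\<pi> y = a" | "\<pi> x \<noteq> a" "\<pi> x \<noteq> b" | "\<pi> y \<noteq> a" "\<pi> y \<noteq> b"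
      using ne by metis
    then show "T x' y' = Some s"
    proof cases
      case 1
      then show ?thesis using copy_map_compat[OF vw \<open>a \<noteq> b\<close> T _ _ eq] by blast
    next
      case 2
      then show ?thesis
        using copy_map_compat[OF vw \<open>a \<noteq> b\<close> T' _ _ eq(2,1)] typed_graphD(2)[OF G] by metis
    next
      case 3
      then have "w = v" "x' = x" using copy_map_eqD(4)[OF vw eq(1)] by auto
      moreover have "y' = y" using copy_map_inj[OF vw(1) \<open>a \<noteq> b\<close>] eq(2) \<open>w = v\<close> by metis
      ultimately show ?thesis using T by simp
    next
      case 4
      then have "w = v" "y' = y" using copy_map_eqD(4)[OF vw eq(2)] by auto
      moreover have "x' = x" using copy_map_inj[OF vw(1) \<open>a \<noteq> b\<close>] eq(1) \<open>w = v\<close> by metis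
      ultimately show ?thesis using T by simp
    qed
  next
    fix S s assume S: "S \<subseteq> (\<Union>v\<in>L. copy_map \<pi> a b v ` V)" "card S = q" and cl: "type_clique ?glue s S"
    have inj: "inj_on (copy_part \<pi>) S"
      using cl parts by (fastforce simp: type_clique_def partite_def inj_on_def)
    have "\<not> copy_part \<pi> ` S \<subseteq> {a, b}"
    proof
      assume "copy_part \<pi> ` S \<subseteq> {a, b}"
      then have "card (copy_part \<pi> ` S) \<le> card {a, b}" by (intro card_mono) auto
      also have "\<dots> \<le> 2" by (simp add: card_insert_le_m1)
      finally show False using card_image[OF inj] S(2) \<open>q \<ge> 3\<close> by simp
    qed
    then obtain u where u: "u \<in> S" "copy_part \<pi> u \<noteq> a" "copy_part \<pi> u \<noteq> b" by blast
    then obtain v x where v: "v \<in> L" "x \<in> V" "u = copy_map \<pi> a b v x" using S(1) by blast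
    then have vw: "variable_word ?A N v" by (simp add: L)
    have x: "\<pi> x \<noteq> a" "\<pi> x \<noteq> b" using u v copy_part_copy_map[OF vw] by auto
    have "z \<in> copy_map \<pi> a b v ` V" if z: "z \<in> S" for z
    proof (cases "z = u")
      case False
      then have "?glue u z = Some s" using cl u z by (auto simp: type_clique_def)
      then obtain w x' y where w: "w \<in> L" "u = copy_map \<pi> a b w x'" "z = copy_map \<pi> a b w y" "T x' y = Some s"
        by (rule glue_SomeD)
      have "w = v" using copy_map_eqD(4)[OF vw _ _ x, of w x'] w v by (auto simp: L)
      then show ?thesis using w typed_graphD(4)[OF G w(4)] by auto
    qed (use v in auto)
    then show "\<exists>v\<in>L. S \<subseteq> copy_map \<pi> a b v ` V" using v(1) by blast
  qed (use finL G in auto)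
qed

text \<open>The alphabet is the set of edges of type \<open>t\<close> from part \<open>a\<close> to
  part \<open>b\<close>. A word of edges is coloured like the edge that joins its word of first
  endpoints to its word of second endpoints. The variable word of a monochromatic line is then a
  copy in which all these edges have one colour.\<close>

lemma partite_step:
  assumes G: "typed_graph q r V T" and "q \<ge> 3" and pi: "partite \<pi> T" and "a \<noteq> b"
  shows "\<exists>V' T' \<pi>'. typed_graph q r V' T' \<and> partite \<pi>' T' \<and>
    (\<forall>\<chi> :: nat set \<Rightarrow> nat. (\<forall>e. \<chi> e < r) \<longrightarrow>
      (\<exists>f. embeds f V T V' T' \<and> (\<forall>x\<in>V. \<pi>' (f x) = \<pi> x) \<and>
        (\<exists>d. \<forall>(x, y) \<in> part_edges \<pi> T t a b. \<chi> {f x, f y} = d)))"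
proof -
  let ?A = "part_edges \<pi> T t a b"
  have "?A \<subseteq> V \<times> V" using typed_graphD[OF G] by (auto simp: part_edges_def)
  then have "finite ?A" using typed_graphD(1)[OF G] by (meson finite_SigmaI finite_subset)
  then obtain N where N: "\<And>c :: (nat \<times> nat) list \<Rightarrow> nat. (\<And>w. c w < r) \<Longrightarrow> mono_line ?A N c"
    using hales_jewett[of ?A r] by blast
  define L where "L = {v. variable_word ?A N v}"
  let ?V = "\<Union>v\<in>L. copy_map \<pi> a b v ` V" and ?T = "glue L (copy_map \<pi> a b) (\<lambda>_. T)"
  note gl = copy_map_gluing[OF G \<open>q \<ge> 3\<close> pi \<open>a \<noteq> b\<close> L_def]
  have "\<exists>f. embeds f V T ?V ?T \<and> (\<forall>x\<in>V. copy_part \<pi> (f x) = \<pi> x) \<and>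
        (\<exists>d. \<forall>(x, y) \<in> ?A. \<chi> {f x, f y} = d)" if \<chi>: "\<forall>e. \<chi> e < r" for \<chi> :: "nat set \<Rightarrow> nat"
  proof -
    \<comment> \<open>\<open>enc\<close> is the code that \<open>copy_map\<close> gives to vertices
      of the parts \<open>a\<close> and \<open>b\<close>.\<close>
    define enc where "enc l = to_nat (Inl l :: nat list + (nat \<times> nat) option list \<times> nat)" for l
    obtain v d where v: "variable_word ?A N v"
      and d: "\<forall>e\<in>?A. \<chi> {enc (map fst (fill e v)), enc (map snd (fill e v))} = d"
      using N[of "\<lambda>w. \<chi> {enc (map fst w), enc (map snd w)}"] \<chi> by (auto simp: mono_line_def)
    have "\<chi> {copy_map \<pi> a b v x, copy_map \<pi> a b v y} = d" if xy: "(x, y) \<in> ?A" for x y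
    proof -
      have "copy_map \<pi> a b v x = enc (map fst (fill (x, y) v))"
        using xy by (auto simp: copy_map_def enc_def fill_def part_edges_def split: option.splits)
      moreover have "copy_map \<pi> a b v y = enc (map snd (fill (x, y) v))"
        using xy \<open>a \<noteq> b\<close> by (auto simp: copy_map_def enc_def fill_def part_edges_def split: option.splits)
      ultimately show ?thesis using d xy by simp
    qed
    moreover have "embeds (copy_map \<pi> a b v) V T ?V ?T"
      using gluing.embeds_glue[OF gl(1), of v] v by (simp add: L_def)
    ultimately show ?thesis using copy_part_copy_map[OF v] by blast
  qed
  then show ?thesis using gluing.typed_graph_glue[OF gl(1)] gl(2) by blast
qed

text \<open>The pairs in \<open>D\<close> are treated one after another, each by
  \<open>partite_step\<close> applied to the graph reached so far.\<close>

lemma partite_construction: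
  assumes "finite D" and "\<forall>(a, b) \<in> D. a \<noteq> b"
    and "typed_graph q r V T" and "q \<ge> 3" and "partite \<pi> T"
  shows "\<exists>V' T' \<pi>'. typed_graph q r V' T' \<and> partite \<pi>' T' \<and>
    (\<forall>\<chi> :: nat set \<Rightarrow> nat. (\<forall>e. \<chi> e < r) \<longrightarrow>
      (\<exists>f. embeds f V T V' T' \<and> (\<forall>x\<in>V. \<pi>' (f x) = \<pi> x) \<and>
        (\<forall>(a, b) \<in> D. \<exists>d. \<forall>(x, y) \<in> part_edges \<pi> T t a b. \<chi> {f x, f y} = d)))"
  using assms
proof (induction D arbitrary: V T \<pi>)
  case empty
  have "embeds (\<lambda>x. x) V T V T" by (auto simp: embeds_def)
  then show ?case using empty by blast
next
  case (insert ab D)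
  obtain a b where ab: "ab = (a, b)" by fastforce
  with insert.prems have "a \<noteq> b" by auto
  obtain U R \<rho> where U: "typed_graph q r U R" "partite \<rho> R"
    and step: "\<forall>\<chi> :: nat set \<Rightarrow> nat. (\<forall>e. \<chi> e < r) \<longrightarrow>
      (\<exists>f. embeds f V T U R \<and> (\<forall>x\<in>V. \<rho> (f x) = \<pi> x) \<and>
        (\<exists>d. \<forall>(x, y) \<in> part_edges \<pi> T t a b. \<chi> {f x, f y} = d))"
    using partite_step[OF insert.prems(2-4) \<open>a \<noteq> b\<close>, of t] by (elim exE conjE) (rule that)
  have D: "\<forall>(a, b) \<in> D. a \<noteq> b" using insert.prems(1) by simp
  note IH' = insert.IH[OF D U(1) \<open>q \<ge> 3\<close> U(2)]
  obtain V' T' \<pi>' where V': "typed_graph q r V' T'" "partite \<pi>' T'"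
    and IH: "\<forall>\<chi> :: nat set \<Rightarrow> nat. (\<forall>e. \<chi> e < r) \<longrightarrow>
      (\<exists>g. embeds g U R V' T' \<and> (\<forall>x\<in>U. \<pi>' (g x) = \<rho> x) \<and>
        (\<forall>(a, b) \<in> D. \<exists>d. \<forall>(x, y) \<in> part_edges \<rho> R t a b. \<chi> {g x, g y} = d))"
    using IH' by (elim exE conjE) (rule that)
  have "\<exists>f. embeds f V T V' T' \<and> (\<forall>x\<in>V. \<pi>' (f x) = \<pi> x) \<and>
        (\<forall>(a, b) \<in> insert ab D. \<exists>d. \<forall>(x, y) \<in> part_edges \<pi> T t a b. \<chi> {f x, f y} = d)"
    if \<chi>: "\<forall>e. \<chi> e < r" for \<chi> :: "nat set \<Rightarrow> nat"
  proof -
    obtain g where g: "embeds g U R V' T'" "\<And>x. x \<in> U \<Longrightarrow> \<pi>' (g x) = \<rho> x"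
        "\<And>a b. (a, b) \<in> D \<Longrightarrow> \<exists>d. \<forall>(x, y) \<in> part_edges \<rho> R t a b. \<chi> {g x, g y} = d"
      using mp[OF spec[OF IH, of \<chi>] \<chi>] by blast
    \<comment> \<open>The colouring is pulled back along \<open>g\<close> to the intermediate graph
      on \<open>U\<close>, where the step for \<open>(a, b)\<close> finds a copy of
      \<open>T\<close>.\<close>
    have \<chi>': "\<forall>e. \<chi> (g ` e) < r" using \<chi> by blast
    obtain f d where f: "embeds f V T U R" "\<And>x. x \<in> V \<Longrightarrow> \<rho> (f x) = \<pi> x"
        "\<forall>(x, y) \<in> part_edges \<pi> T t a b. \<chi> (g ` {f x, f y}) = d"
      using mp[OF spec[OF step, of "\<lambda>e. \<chi> (g ` e)"] \<chi>'] by blast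
    have fU: "f x \<in> U" if "x \<in> V" for x using f(1) that by (auto simp: embeds_def)
    have "\<exists>d. \<forall>(x, y) \<in> part_edges \<pi> T t a' b'. \<chi> {(g \<circ> f) x, (g \<circ> f) y} = d"
      if "(a', b') \<in> insert ab D" for a' b'
    proof (cases "(a', b') \<in> D")
      case True
      then obtain d' where d': "\<forall>(x, y) \<in> part_edges \<rho> R t a' b'. \<chi> {g x, g y} = d'" using g(3) by blast
      \<comment> \<open>Since \<open>f\<close> preserves types and parts, what \<open>g\<close>
        achieves for the pairs in \<open>D\<close> is inherited by
        \<open>g \<circ> f\<close>.\<close>
      have "(f x, f y) \<in> part_edges \<rho> R t a' b'" if "(x, y) \<in> part_edges \<pi> T t a' b'" for x y
        using that f(1,2) typed_graphD(3,4)[OF insert.prems(2)]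
        by (auto simp: part_edges_def embeds_def)
      then have "\<forall>(x, y) \<in> part_edges \<pi> T t a' b'. \<chi> {(g \<circ> f) x, (g \<circ> f) y} = d'"
        using bspec[OF d'] by fastforce
      then show ?thesis by blast
    next
      case False
      then show ?thesis using that ab f(3) by (intro exI[of _ d]) auto
    qed
    moreover have "\<forall>x\<in>V. \<pi>' ((g \<circ> f) x) = \<pi> x" using g(2) f(2) fU by simp
    ultimately show ?thesis using embeds_trans[OF f(1) g(1)] by blast
  qed
  then show ?case using V' by blast
qed

section \<open>From pairs of parts to whole types, by Ramsey's theorem\<close>

text \<open>Place a copy of \<open>T\<close> on every choice of \<open>n\<close> out of
  \<open>p\<close> parts, one vertex to a part. The partite construction makes the colour of an edge
  of type \<open>t\<close> depend only on the two parts it joins. For \<open>p\<close> large,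
  Ramsey's theorem for pairs of parts gives \<open>n\<close> parts on which this colour is constant,
  and the copy placed there is as required.\<close>

lemma monochromatic_type_step:
  assumes G: "typed_graph q r V T" and "q \<ge> 3"
  shows "\<exists>V' T'. typed_graph q r V' T' \<and>
    (\<forall>\<chi> :: nat set \<Rightarrow> nat. (\<forall>e. \<chi> e < r) \<longrightarrow>
      (\<exists>f. embeds f V T V' T' \<and> (\<exists>d. \<forall>x y. T x y = Some t \<longrightarrow> \<chi> {f x, f y} = d)))"
proof -
  define n where "n = card V"
  have finV: "finite V" by (rule typed_graphD(1)[OF G])
  obtain idx where idx: "bij_betw idx V {0..<n}"
    using ex_bij_betw_finite_nat[OF finV] unfolding n_def by blast
  then have idx_less: "idx x < n" if "x \<in> V" for x
    using bij_betwE that by fastforce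
  obtain p :: nat where p: "partn_lst {..<p} (replicate r n) 2" using ramsey_full by blast
  \<comment> \<open>The lists in \<open>I\<close> are the injective placements: \<open>l\<close>
    puts the vertex \<open>x\<close> into the part \<open>l ! idx x\<close>.\<close>
  define I where "I = {l :: nat list. (set l \<subseteq> {..<p} \<and> length l = n) \<and> distinct l}"
  have finI: "finite I"
    unfolding I_def by (rule finite_subset[OF _ finite_lists_length_eq[of "{..<p}" n]]) auto
  define \<psi> where "\<psi> l x = to_nat (l, x)" for l :: "nat list" and x :: nat
  let ?U = "\<Union>l\<in>I. \<psi> l ` V" and ?R = "glue I \<psi> (\<lambda>_. T)"
  define \<pi> where "\<pi> u = (case from_nat u :: nat list \<times> nat of (l, x) \<Rightarrow> l ! idx x)" for u
  have \<pi>: "\<pi> (\<psi> l x) = l ! idx x" for l x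
    by (simp add: \<pi>_def \<psi>_def)
  have gl: "gluing q r I (\<lambda>_. V) (\<lambda>_. T) \<psi>"
    unfolding \<psi>_def using \<open>q \<ge> 3\<close> by (intro disjoint_union_gluing finI G) auto
  have nth_ne: "l ! idx x \<noteq> l ! idx y" if "l \<in> I" "T x y = Some s" for l x y s
  proof -
    have xy: "x \<in> V" "y \<in> V" "x \<noteq> y" using typed_graphD(3-5)[OF G that(2)] .
    then have "idx x \<noteq> idx y" using idx by (metis bij_betw_inv_into_left)
    then show ?thesis using that(1) idx_less xy by (simp add: I_def nth_eq_iff_index_eq)
  qed
  have part: "partite \<pi> ?R"
    unfolding partite_def
  proof (intro allI impI)
    fix u w assume "?R u w \<noteq> None"
    then obtain s where "?R u w = Some s" by blast
    then obtain l x y where "l \<in> I" "u = \<psi> l x" "w = \<psi> l y" "T x y = Some s"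
      by (rule glue_SomeD)
    then show "\<pi> u \<noteq> \<pi> w" using nth_ne \<pi> by simp
  qed
  define D where "D = {(a, b). a < p \<and> b < p \<and> a \<noteq> b}"
  have "D \<subseteq> {..<p} \<times> {..<p}" by (auto simp: D_def)
  then have finD: "finite D" by (meson finite_SigmaI finite_subset finite_lessThan)
  have D: "\<forall>(a, b) \<in> D. a \<noteq> b" by (auto simp: D_def)
  obtain V' T' \<pi>' where V': "typed_graph q r V' T'"
    and ex: "\<forall>\<chi> :: nat set \<Rightarrow> nat. (\<forall>e. \<chi> e < r) \<longrightarrow>
      (\<exists>f. embeds f ?U ?R V' T' \<and> (\<forall>x\<in>?U. \<pi>' (f x) = \<pi> x) \<and>
        (\<forall>(a, b) \<in> D. \<exists>d. \<forall>(x, y) \<in> part_edges \<pi> ?R t a b. \<chi> {f x, f y} = d))"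
    using partite_construction[OF finD D gluing.typed_graph_glue[OF gl] \<open>q \<ge> 3\<close> part, of t]
    by (elim exE conjE) (rule that)
  have "\<exists>f. embeds f V T V' T' \<and> (\<exists>d. \<forall>x y. T x y = Some t \<longrightarrow> \<chi> {f x, f y} = d)"
    if \<chi>: "\<forall>e. \<chi> e < r" for \<chi> :: "nat set \<Rightarrow> nat"
  proof -
    obtain f where f: "embeds f ?U ?R V' T'"
      and colD: "\<forall>(a, b) \<in> D. \<exists>d. \<forall>(x, y) \<in> part_edges \<pi> ?R t a b. \<chi> {f x, f y} = d"
      using mp[OF spec[OF ex, of \<chi>] \<chi>] by (elim exE conjE) (rule that)
    have col: "\<exists>d. \<forall>(x, y) \<in> part_edges \<pi> ?R t a b. \<chi> {f x, f y} = d" if "(a, b) \<in> D" for a b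
      using bspec[OF colD that] by (simp only: prod.case)
    define \<delta> where "\<delta> a b = (SOME d. \<forall>(x, y) \<in> part_edges \<pi> ?R t a b. \<chi> {f x, f y} = d)" for a b
    have \<delta>: "\<chi> {f x, f y} = \<delta> a b" if "(a, b) \<in> D" "(x, y) \<in> part_edges \<pi> ?R t a b" for a b x y
      using bspec[OF someI_ex[OF col[OF that(1)]] that(2)] by (simp only: \<delta>_def prod.case)
    have "r > 0" using \<chi> by (metis gr0I not_less0)
    \<comment> \<open>Where no edge of type \<open>t\<close> joins two parts,
      \<open>\<delta>\<close> is arbitrary; the default 0 keeps the colours of
      \<open>\<kappa>\<close> below \<open>r\<close>.\<close>
    define \<kappa> where "\<kappa> e = (let d = \<delta> (Min e) (Max e) in if d < r then d else 0)" for e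
    have "\<kappa> \<in> nsets {..<p} 2 \<rightarrow> {..<length (replicate r n)}"
      using \<open>r > 0\<close> by (auto simp: \<kappa>_def Let_def)
    then obtain i where "i < r" "monochromatic {..<p} (replicate r n ! i) 2 \<kappa> i"
      using p unfolding partn_lst_def by (metis length_replicate)
    then obtain H where H: "H \<in> nsets {..<p} n" "\<kappa> ` nsets H 2 \<subseteq> {i}"
      by (auto simp: monochromatic_def)
    \<comment> \<open>This listing of \<open>H\<close> is one of the placements in \<open>I\<close>,
      so a copy of \<open>T\<close> sits on the homogeneous parts.\<close>
    define l where "l = sorted_list_of_set H"
    have l: "l \<in> I" "set l = H"
      using H(1) by (auto simp: l_def I_def nsets_def)
    have emb: "embeds (\<psi> l) V T ?U ?R" using gluing.embeds_glue[OF gl l(1)] .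
    have lt: "\<chi> {f (\<psi> l x), f (\<psi> l y)} = i" if T: "T x y = Some t" and less: "l ! idx x < l ! idx y" for x y
    proof -
      let ?a = "l ! idx x" and ?b = "l ! idx y"
      have xy: "x \<in> V" "y \<in> V" using typed_graphD(3,4)[OF G T] .
      then have ab: "?a \<in> H" "?b \<in> H" using idx_less l by (auto simp: I_def)
      then have "(?a, ?b) \<in> D" using less H(1) by (auto simp: D_def nsets_def)
      moreover have "(\<psi> l x, \<psi> l y) \<in> part_edges \<pi> ?R t ?a ?b"
        using emb T \<pi> by (auto simp: part_edges_def embeds_def)
      ultimately have d: "\<chi> {f (\<psi> l x), f (\<psi> l y)} = \<delta> ?a ?b" by (rule \<delta>)
      have "{?a, ?b} \<in> nsets H 2" using ab less by auto
      then have "\<kappa> {?a, ?b} = i" using H(2) by blast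
      \<comment> \<open>By \<open>d\<close> the value of \<open>\<delta>\<close> is the colour of an
        edge, so the default is not taken.\<close>
      moreover have "\<kappa> {?a, ?b} = \<delta> ?a ?b"
        using less \<chi> d by (simp add: \<kappa>_def Let_def min_def max_def) (metis d)
      ultimately show ?thesis using d by simp
    qed
    have "\<chi> {(f \<circ> \<psi> l) x, (f \<circ> \<psi> l) y} = i" if T: "T x y = Some t" for x y
    proof (cases "l ! idx x < l ! idx y")
      case True
      then show ?thesis using lt[OF T] by simp
    next
      case False
      have T': "T y x = Some t" using T typed_graphD(2)[OF G] by simp
      have "l ! idx y < l ! idx x" using False nth_ne[OF l(1) T] by simp
      then show ?thesis using lt[OF T'] by (simp add: insert_commute)
    qed
    then show ?thesis using embeds_trans[OF emb f] by blast
  qed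
  then show ?thesis using V' by blast
qed

text \<open>One type is treated at a time. Embeddings preserve types, so a copy found inside a graph
  whose edges of some type have one colour keeps that property.\<close>

lemma monochromatic_types:
  assumes "typed_graph q r V T" and "q \<ge> 3"
  shows "\<exists>V' T'. typed_graph q r V' T' \<and>
    (\<forall>\<chi> :: nat set \<Rightarrow> nat. (\<forall>e. \<chi> e < r) \<longrightarrow>
      (\<exists>f. embeds f V T V' T' \<and> (\<forall>t<m. \<exists>d. \<forall>x y. T x y = Some t \<longrightarrow> \<chi> {f x, f y} = d)))"
  using assms
proof (induction m arbitrary: V T)
  case 0
  have "embeds (\<lambda>x. x) V T V T" by (auto simp: embeds_def)
  then show ?case using 0 by blast
next
  case (Suc m)
  obtain U R where U: "typed_graph q r U R"
    and step: "\<forall>\<chi> :: nat set \<Rightarrow> nat. (\<forall>e. \<chi> e < r) \<longrightarrow>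
      (\<exists>f. embeds f V T U R \<and> (\<exists>d. \<forall>x y. T x y = Some m \<longrightarrow> \<chi> {f x, f y} = d))"
    using monochromatic_type_step[OF Suc.prems, of m] by (elim exE conjE) (rule that)
  obtain V' T' where V': "typed_graph q r V' T'"
    and IH: "\<forall>\<chi> :: nat set \<Rightarrow> nat. (\<forall>e. \<chi> e < r) \<longrightarrow>
      (\<exists>f. embeds f U R V' T' \<and> (\<forall>t<m. \<exists>d. \<forall>x y. R x y = Some t \<longrightarrow> \<chi> {f x, f y} = d))"
    using Suc.IH[OF U \<open>q \<ge> 3\<close>] by (elim exE conjE) (rule that)
  have "\<exists>f. embeds f V T V' T' \<and> (\<forall>t<Suc m. \<exists>d. \<forall>x y. T x y = Some t \<longrightarrow> \<chi> {f x, f y} = d)"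
    if \<chi>: "\<forall>e. \<chi> e < r" for \<chi> :: "nat set \<Rightarrow> nat"
  proof -
    obtain g where g: "embeds g U R V' T'"
      "\<And>t. t < m \<Longrightarrow> \<exists>d. \<forall>x y. R x y = Some t \<longrightarrow> \<chi> {g x, g y} = d"
      using mp[OF spec[OF IH, of \<chi>] \<chi>] by blast
    have \<chi>': "\<forall>e. \<chi> (g ` e) < r" using \<chi> by blast
    obtain f d where f: "embeds f V T U R" "\<And>x y. T x y = Some m \<Longrightarrow> \<chi> (g ` {f x, f y}) = d"
      using mp[OF spec[OF step, of "\<lambda>e. \<chi> (g ` e)"] \<chi>'] by blast
    have "\<exists>d. \<forall>x y. T x y = Some t \<longrightarrow> \<chi> {(g \<circ> f) x, (g \<circ> f) y} = d" if "t < Suc m" for t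
    proof (cases "t = m")
      case True
      then show ?thesis using f(2) by auto
    next
      case False
      then obtain d' where d': "\<And>x y. R x y = Some t \<Longrightarrow> \<chi> {g x, g y} = d'"
        using g(2) \<open>t < Suc m\<close> less_SucE by blast
      have "\<chi> {(g \<circ> f) x, (g \<circ> f) y} = d'" if "T x y = Some t" for x y
        using d' that f(1) by (simp add: embeds_def)
      then show ?thesis by blast
    qed
    then show ?thesis using embeds_trans[OF f(1) g(1)] by blast
  qed
  then show ?case using V' by blast
qed

section \<open>Distinct colours for distinct types\<close>

definition two_type_clique :: "nat \<Rightarrow> nat \<Rightarrow> nat \<Rightarrow> nat \<Rightarrow> nat \<Rightarrow> nat option" where
  "two_type_clique q i j x y =
     (if x < q \<and> y < q \<and> x \<noteq> y then Some (if {x, y} = {0, 1} then i else j) else None)"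

text \<open>The only set of \<open>q\<close> vertices is the whole clique, and its edges
  \<open>{0, 1}\<close> and \<open>{0, 2}\<close> have different types.\<close>

lemma typed_graph_two_type_clique:
  assumes "q \<ge> 3" "i < r" "j < r" "i \<noteq> j"
  shows "typed_graph q r {..<q} (two_type_clique q i j)"
  unfolding typed_graph_def
proof (intro conjI allI impI)
  fix S s assume S: "S \<subseteq> {..<q} \<and> card S = q"
  then have "S = {..<q}" by (metis card_lessThan card_subset_eq finite_lessThan)
  then have mem: "0 \<in> S" "1 \<in> S" "2 \<in> S" using \<open>q \<ge> 3\<close> by auto
  show "\<not> type_clique (two_type_clique q i j) s S"
  proof
    assume "type_clique (two_type_clique q i j) s S"
    then have "two_type_clique q i j 0 1 = two_type_clique q i j 0 2"
      using mem by (simp add: type_clique_def)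
    then show False using assms by (auto simp: two_type_clique_def doubleton_eq_iff)
  qed
qed (use assms in \<open>auto simp: two_type_clique_def insert_commute split: if_splits\<close>)

text \<open>The two-type cliques ensure that distinct types receive distinct colours unless a
  monochromatic clique appears.\<close>
lemma pattern_forcing:
  assumes G: "typed_graph q r V T" and "q \<ge> 3" and "r \<ge> 2"
  shows "\<exists>V' T'. typed_graph q r V' T' \<and>
    (\<forall>\<chi> :: nat set \<Rightarrow> nat. (\<forall>e. \<chi> e < r) \<longrightarrow>
      (\<exists>S\<subseteq>V'. card S = q \<and> (\<exists>d. \<forall>x\<in>S. \<forall>y\<in>S. x \<noteq> y \<longrightarrow> T' x y \<noteq> None \<and> \<chi> {x, y} = d)) \<or>
      (\<exists>f \<tau>. embeds f V T V' T' \<and> inj_on \<tau> {..<r} \<and> \<tau> ` {..<r} \<subseteq> {..<r} \<and>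
        (\<forall>x y s. T x y = Some s \<longrightarrow> \<chi> {f x, f y} = \<tau> s)))"
proof -
  \<comment> \<open>\<open>None\<close> is the index of the given graph, \<open>Some (i, j)\<close>
    that of the two-type clique for \<open>i\<close> and \<open>j\<close>.\<close>
  define I :: "(nat \<times> nat) option set" where
    "I = insert None (Some ` {(i, j). i < r \<and> j < r \<and> i \<noteq> j})"
  define VV where "VV = case_option V (\<lambda>_ :: nat \<times> nat. {..<q})"
  define TT where "TT = case_option T (\<lambda>(i, j). two_type_clique q i j)"
  define \<psi> where "\<psi> z x = to_nat (z, x)" for z :: "(nat \<times> nat) option" and x :: nat
  have "{(i, j). i < r \<and> j < r \<and> i \<noteq> j} \<subseteq> {..<r} \<times> {..<r}" by auto
  then have "finite {(i, j). i < r \<and> j < r \<and> i \<noteq> j}"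
    by (meson finite_SigmaI finite_subset finite_lessThan)
  then have finI: "finite I" by (simp add: I_def)
  have typed: "typed_graph q r (VV i) (TT i)" if "i \<in> I" for i
    using that G typed_graph_two_type_clique[OF \<open>q \<ge> 3\<close>] by (auto simp: I_def VV_def TT_def)
  have gl: "gluing q r I VV TT \<psi>"
    unfolding \<psi>_def using \<open>q \<ge> 3\<close> by (intro disjoint_union_gluing finI typed) auto
  let ?U = "\<Union>i\<in>I. \<psi> i ` VV i" and ?R = "glue I \<psi> TT"
  obtain V' T' where V': "typed_graph q r V' T'"
    and ex: "\<forall>\<chi> :: nat set \<Rightarrow> nat. (\<forall>e. \<chi> e < r) \<longrightarrow>
      (\<exists>f. embeds f ?U ?R V' T' \<and> (\<forall>t<r. \<exists>d. \<forall>x y. ?R x y = Some t \<longrightarrow> \<chi> {f x, f y} = d))"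
    using monochromatic_types[OF gluing.typed_graph_glue[OF gl] \<open>q \<ge> 3\<close>, of r]
    by (elim exE conjE) (rule that)
  have "(\<exists>S\<subseteq>V'. card S = q \<and> (\<exists>d. \<forall>x\<in>S. \<forall>y\<in>S. x \<noteq> y \<longrightarrow> T' x y \<noteq> None \<and> \<chi> {x, y} = d)) \<or>
      (\<exists>f \<tau>. embeds f V T V' T' \<and> inj_on \<tau> {..<r} \<and> \<tau> ` {..<r} \<subseteq> {..<r} \<and>
        (\<forall>x y s. T x y = Some s \<longrightarrow> \<chi> {f x, f y} = \<tau> s))"
    if \<chi>: "\<forall>e. \<chi> e < r" for \<chi> :: "nat set \<Rightarrow> nat"
  proof -
    obtain f where f: "embeds f ?U ?R V' T'"
      and mono: "\<forall>t<r. \<exists>d. \<forall>x y. ?R x y = Some t \<longrightarrow> \<chi> {f x, f y} = d"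
      using mp[OF spec[OF ex, of \<chi>] \<chi>] by blast
    have "\<forall>t. \<exists>d. t < r \<longrightarrow> (\<forall>x y. ?R x y = Some t \<longrightarrow> \<chi> {f x, f y} = d)"
      using mono by blast
    then obtain \<tau> where "\<forall>t. t < r \<longrightarrow> (\<forall>x y. ?R x y = Some t \<longrightarrow> \<chi> {f x, f y} = \<tau> t)"
      by (rule choice[THEN exE])
    then have \<tau>: "\<chi> {f x, f y} = \<tau> t" if "t < r" "?R x y = Some t" for x y t
      using that by blast
    have emb: "embeds (f \<circ> \<psi> z) (VV z) (TT z) V' T'" if "z \<in> I" for z
      using embeds_trans[OF gluing.embeds_glue[OF gl that] f] .
    have col: "\<chi> {(f \<circ> \<psi> z) x, (f \<circ> \<psi> z) y} = \<tau> t" if "z \<in> I" "TT z x y = Some t" for z x y t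
    proof -
      have "?R (\<psi> z x) (\<psi> z y) = Some t"
        using gluing.embeds_glue[OF gl that(1)] that(2) by (auto simp: embeds_def)
      moreover have "t < r" using typed_graphD(6)[OF typed[OF that(1)] that(2)] .
      ultimately show ?thesis using \<tau> by simp
    qed
    have gadget: "(\<exists>S\<subseteq>V'. card S = q \<and> (\<exists>d. \<forall>x\<in>S. \<forall>y\<in>S. x \<noteq> y \<longrightarrow> T' x y \<noteq> None \<and> \<chi> {x, y} = d))"
      if ij: "i < r" "j < r" "i \<noteq> j" "\<tau> i = \<tau> j" for i j
    proof -
      let ?z = "Some (i, j)" let ?g = "f \<circ> \<psi> ?z"
      have z: "?z \<in> I" using ij by (auto simp: I_def)
      have e: "inj_on ?g {..<q}" "?g ` {..<q} \<subseteq> V'"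
        and eT: "\<And>x y s. two_type_clique q i j x y = Some s \<Longrightarrow> T' (?g x) (?g y) = Some s"
        using emb[OF z] by (auto simp: embeds_def VV_def TT_def)
      have "T' (?g x) (?g y) \<noteq> None \<and> \<chi> {?g x, ?g y} = \<tau> i"
        if xy: "x < q" "y < q" "?g x \<noteq> ?g y" for x y
      proof -
        have "x \<noteq> y" using xy by blast
        then obtain s where s: "two_type_clique q i j x y = Some s" "s = i \<or> s = j"
          using xy by (simp add: two_type_clique_def)
        have "\<chi> {?g x, ?g y} = \<tau> s" using col[OF z, of x y s] s(1) by (simp add: TT_def)
        then show ?thesis using eT[OF s(1)] s(2) ij(4) by auto
      qed
      then have "\<forall>u\<in>?g ` {..<q}. \<forall>w\<in>?g ` {..<q}. u \<noteq> w \<longrightarrow> T' u w \<noteq> None \<and> \<chi> {u, w} = \<tau> i"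
        by blast
      moreover have "card (?g ` {..<q}) = q" using card_image[OF e(1)] by simp
      ultimately show ?thesis using e(2) by blast
    qed
    \<comment> \<open>\<open>T\<close> itself may have no edge of type \<open>t\<close>; a two-type
      clique, with some second type \<open>j\<close>, supplies one, so that \<open>\<tau> t\<close>
      is the colour of an edge.\<close>
    have "\<tau> t < r" if "t < r" for t
    proof -
      obtain j where j: "j < r" "j \<noteq> t" using \<open>r \<ge> 2\<close>
        by (metis One_nat_def less_2_cases_iff less_le_trans zero_neq_one)
      have z: "Some (t, j) \<in> I" using j that by (auto simp: I_def)
      have "TT (Some (t, j)) 0 1 = Some t" using \<open>q \<ge> 3\<close> by (simp add: TT_def two_type_clique_def)
      then show ?thesis using col[OF z] \<chi> by metis
    qed
    then have \<tau>r: "\<tau> ` {..<r} \<subseteq> {..<r}" by blast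
    have None: "None \<in> I" by (simp add: I_def)
    have emb0: "embeds (f \<circ> \<psi> None) V T V' T'" using emb[OF None] by (simp add: VV_def TT_def)
    have col0: "\<forall>x y s. T x y = Some s \<longrightarrow> \<chi> {(f \<circ> \<psi> None) x, (f \<circ> \<psi> None) y} = \<tau> s"
      using col[OF None] by (simp add: TT_def)
    show ?thesis
    proof (cases "inj_on \<tau> {..<r}")
      case True
      then show ?thesis using emb0 col0 \<tau>r by blast
    next
      case False
      then obtain i j where "i < r" "j < r" "i \<noteq> j" "\<tau> i = \<tau> j" by (auto simp: inj_on_def)
      then show ?thesis using gadget by blast
    qed
  qed
  then show ?thesis using V' by blast
qed

subsection \<open>From typed graphs to Ramsey-minimal graphs\<close>

lemma has_copy_clique:
  assumes "q > 0"
  shows "has_copy (K_vert q) (K_edges q) V E \<longleftrightarrow> (\<exists>S\<subseteq>V. card S = q \<and> is_clique E S)"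
proof
  assume "has_copy (K_vert q) (K_edges q) V E"
  then obtain f where f: "inj_on f {0..<q}" "f ` {0..<q} \<subseteq> V" "\<forall>e\<in>K_edges q. f ` e \<in> E"
    by (auto simp: has_copy_def K_vert_def)
  have "is_clique E (f ` {0..<q})"
    unfolding is_clique_def
  proof (intro ballI impI)
    fix x y assume "x \<in> f ` {0..<q}" "y \<in> f ` {0..<q}" "x \<noteq> y"
    then obtain i j where ij: "i < q" "j < q" "x = f i" "y = f j" "i \<noteq> j"
      by (metis atLeastLessThan_iff imageE)
    then have "{i, j} \<in> K_edges q" by (simp add: K_edges_def)
    then have "f ` {i, j} \<in> E" using f(3) by blast
    then show "{x, y} \<in> E" using ij by simp
  qed
  moreover have "card (f ` {0..<q}) = q" using card_image[OF f(1)] by simp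
  ultimately show "\<exists>S\<subseteq>V. card S = q \<and> is_clique E S" using f(2) by blast
next
  assume "\<exists>S\<subseteq>V. card S = q \<and> is_clique E S"
  then obtain S where S: "S \<subseteq> V" "card S = q" "is_clique E S" by blast
  then have "finite S" using assms card_gt_0_iff by blast
  then obtain f where f: "bij_betw f {0..<q} S"
    using ex_bij_betw_nat_finite S(2) by blast
  have "f ` e \<in> E" if "e \<in> K_edges q" for e
  proof -
    from that obtain i j where "e = {i, j}" "i \<noteq> j" "i < q" "j < q"
      by (auto simp: K_edges_def card_2_iff)
    moreover from this have "f i \<in> S" "f j \<in> S" "f i \<noteq> f j"
      using f by (auto simp: bij_betw_def inj_on_def)
    ultimately show ?thesis using S(3) by (auto simp: is_clique_def)
  qed
  then show "has_copy (K_vert q) (K_edges q) V E"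
    using f S(1) unfolding has_copy_def K_vert_def by (metis bij_betw_def)
qed

lemma has_copy_mono:
  assumes "has_copy VH EH V E" "V \<subseteq> V'" "E \<subseteq> E'"
  shows "has_copy VH EH V' E'"
proof -
  obtain f where "inj_on f VH" "f ` VH \<subseteq> V" "\<forall>e\<in>EH. f ` e \<in> E"
    using assms(1) unfolding has_copy_def by (elim exE conjE) (rule that)
  then show ?thesis
    unfolding has_copy_def using assms(2,3) by (intro exI[of _ f]) auto
qed

lemma arrows_mono:
  assumes "arrows V E VH EH r" "V \<subseteq> V'" "E \<subseteq> E'"
  shows "arrows V' E' VH EH r"
  unfolding arrows_def
proof (intro allI impI)
  fix c assume "\<forall>e\<in>E'. c e < r"
  then obtain i where "i < r" "has_copy VH EH V {e \<in> E. c e = i}"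
    using assms unfolding arrows_def by blast
  then have "has_copy VH EH V' {e \<in> E'. c e = i}"
    using assms(2,3) by (elim has_copy_mono) auto
  then show "\<exists>i<r. has_copy VH EH V' {e \<in> E'. c e = i}"
    using \<open>i < r\<close> by blast
qed

lemma is_graph_finite_edges: "is_graph V E \<Longrightarrow> finite E"
  unfolding is_graph_def by (rule finite_subset[of E "Pow V"]) auto

text \<open>Among the arrowing subgraphs take one with the fewest vertices and edges in total;
  removing either kind lowers this sum.\<close>

lemma ramsey_minimal_subgraph:
  assumes "is_graph V E" "arrows V E VH EH r"
  obtains V' E' where "V' \<subseteq> V" "E' \<subseteq> E" "ramsey_minimal V' E' VH EH r"
proof -
  let ?P = "\<lambda>m. \<exists>V' E'. is_graph V' E' \<and> V' \<subseteq> V \<and> E' \<subseteq> E \<and> arrows V' E' VH EH r \<and>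
    card V' + card E' = m"
  have "?P (card V + card E)" using assms by blast
  then have "?P (LEAST m. ?P m)" by (rule LeastI)
  then obtain V' E' where sub: "is_graph V' E'" "V' \<subseteq> V" "E' \<subseteq> E" "arrows V' E' VH EH r"
    and m: "card V' + card E' = (LEAST m. ?P m)" by blast
  have "\<not> arrows V'' E'' VH EH r"
    if "is_graph V'' E''" "V'' \<subseteq> V'" "E'' \<subseteq> E'" "(V'', E'') \<noteq> (V', E')" for V'' E''
  proof
    assume arr: "arrows V'' E'' VH EH r"
    have fin: "finite V'" "finite E'"
      using sub(1) is_graph_finite_edges by (auto simp: is_graph_def)
    have "card V'' \<le> card V'" "card E'' \<le> card E'" using fin that by (simp_all add: card_mono)
    moreover have "card V'' < card V' \<or> card E'' < card E'"
      using fin that psubset_card_mono[of V' V''] psubset_card_mono[of E' E''] by blast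
    ultimately have "card V'' + card E'' < (LEAST m. ?P m)" using m by linarith
    moreover have "(LEAST m. ?P m) \<le> card V'' + card E''"
      by (rule Least_le) (use that sub arr in blast)
    ultimately show False by linarith
  qed
  then have "ramsey_minimal V' E' VH EH r" using sub unfolding ramsey_minimal_def by blast
  then show thesis using that sub by blast
qed

text \<open>A minimal arrowing subgraph does not fit inside \<open>U\<close>, hence has a vertex
  outside it, and degrees do not grow in subgraphs.\<close>

lemma s_r_le:
  assumes G: "is_graph V E" "arrows V E VH EH r"
    and not_arrows: "\<not> arrows U {e \<in> E. e \<subseteq> U} VH EH r"
    and deg: "\<And>u. u \<in> V - U \<Longrightarrow> degree E u \<le> n"
  shows "s_r r VH EH \<le> enat n"
proof -
  obtain V' E' where sub: "V' \<subseteq> V" "E' \<subseteq> E" and min: "ramsey_minimal V' E' VH EH r"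
    using ramsey_minimal_subgraph[OF G] .
  have G': "is_graph V' E'" "arrows V' E' VH EH r" using min by (auto simp: ramsey_minimal_def)
  have "\<not> V' \<subseteq> U"
  proof
    assume "V' \<subseteq> U"
    moreover have "E' \<subseteq> {e \<in> E. e \<subseteq> U}"
      using sub(2) G'(1) \<open>V' \<subseteq> U\<close> by (auto simp: is_graph_def)
    ultimately show False using arrows_mono[OF G'(2)] not_arrows by blast
  qed
  then obtain u where u: "u \<in> V'" "u \<notin> U" by blast
  have "degree E' u \<le> degree E u"
    unfolding degree_def using sub(2) is_graph_finite_edges[OF G(1)] by (intro card_mono) auto
  also have "\<dots> \<le> n" using deg u sub by blast
  finally have "min_degree V' E' \<le> n"
    using u(1) G'(1) unfolding min_degree_def is_graph_def by (meson Min_le finite_imageI imageI le_trans)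
  moreover have "s_r r VH EH \<le> enat (min_degree V' E')"
    unfolding s_r_def by (rule INF_lower2[of "(V', E')"]) (use min in auto)
  ultimately show ?thesis by (meson enat_ord_simps(1) order_trans)
qed

section \<open>Colour patterns as typed graphs, and their underlying graphs\<close>

definition pattern_type :: "nat \<Rightarrow> (nat \<Rightarrow> nat set set) \<Rightarrow> nat \<Rightarrow> nat \<Rightarrow> nat option" where
  "pattern_type r Gs x y =
     (if \<exists>i<r. {x, y} \<in> Gs i then Some (THE i. i < r \<and> {x, y} \<in> Gs i) else None)"

text \<open>The graphs of a colour pattern are edge-disjoint, which makes the \<open>THE\<close> in
  \<open>pattern_type\<close> well defined.\<close>

lemma pattern_type_Some:
  assumes "colour_pattern r V Gs"
  shows "pattern_type r Gs x y = Some i \<longleftrightarrow> i < r \<and> {x, y} \<in> Gs i"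
proof -
  have uniq: "j = i" if "i < r" "{x, y} \<in> Gs i" "j < r" "{x, y} \<in> Gs j" for i j
    using assms that unfolding colour_pattern_def by blast
  have the: "(THE i. i < r \<and> {x, y} \<in> Gs i) = i" if "i < r" "{x, y} \<in> Gs i" for i
    using that uniq by (intro the_equality) blast+
  then show ?thesis unfolding pattern_type_def by auto
qed

lemma typed_graph_pattern:
  assumes "finite V" and pat: "colour_pattern r V Gs"
    and free: "pattern_H_free r V Gs (K_vert q) (K_edges q)" and "q \<ge> 2"
  shows "typed_graph q r V (pattern_type r Gs)"
  unfolding typed_graph_def
proof (intro conjI allI impI)
  show "finite V" by fact
  show "pattern_type r Gs x y = pattern_type r Gs y x" for x y
    by (simp add: pattern_type_def insert_commute)
  fix x y s assume "pattern_type r Gs x y = Some s"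
  then have s: "s < r" "{x, y} \<in> Gs s" using pattern_type_Some[OF pat] by auto
  then have e: "{x, y} \<subseteq> V" "card {x, y} = 2"
    using pat unfolding colour_pattern_def is_graph_def by blast+
  then show "x \<in> V" "y \<in> V" "x \<noteq> y" "s < r" using s by auto
next
  fix S s assume S: "S \<subseteq> V \<and> card S = q"
  show "\<not> type_clique (pattern_type r Gs) s S"
  proof
    assume cl: "type_clique (pattern_type r Gs) s S"
    then have *: "s < r \<and> {x, y} \<in> Gs s" if "x \<in> S" "y \<in> S" "x \<noteq> y" for x y
      using that pattern_type_Some[OF pat] unfolding type_clique_def by blast
    \<comment> \<open>An edge of the clique is needed to see that \<open>s\<close> is below
      \<open>r\<close>, since \<open>type_clique\<close> does not bound \<open>s\<close>.\<close>
    have "\<not> is_singleton S" "S \<noteq> {}" using S \<open>q \<ge> 2\<close> by (auto simp: is_singleton_altdef)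
    then obtain x y where "x \<in> S" "y \<in> S" "x \<noteq> y"
      by (metis ex_in_conv is_singletonI')
    then have "s < r" using * by blast
    moreover have "is_clique (Gs s) S" using * unfolding is_clique_def by blast
    ultimately show False
      using S free \<open>q \<ge> 2\<close> unfolding pattern_H_free_def by (auto simp: has_copy_clique)
  qed
qed

definition shadow :: "(nat \<Rightarrow> nat \<Rightarrow> nat option) \<Rightarrow> nat set set" where
  "shadow T = {{x, y} |x y. T x y \<noteq> None}"

lemma shadow_iff:
  assumes "typed_graph q r V T"
  shows "{x, y} \<in> shadow T \<longleftrightarrow> T x y \<noteq> None"
proof
  assume "{x, y} \<in> shadow T"
  then obtain a b where "{x, y} = {a, b}" "T a b \<noteq> None" by (auto simp: shadow_def)
  then show "T x y \<noteq> None" using typed_graphD(2)[OF assms, of x y] by (metis doubleton_eq_iff)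
next
  show "T x y \<noteq> None \<Longrightarrow> {x, y} \<in> shadow T" unfolding shadow_def by blast
qed

lemma is_graph_shadow:
  assumes "typed_graph q r V T"
  shows "is_graph V (shadow T)"
  unfolding is_graph_def
proof (intro conjI ballI)
  show "finite V" by (rule typed_graphD(1)[OF assms])
  fix e assume "e \<in> shadow T"
  then obtain x y s where e: "e = {x, y}" "T x y = Some s" by (auto simp: shadow_def)
  show "e \<subseteq> V" "card e = 2" using typed_graphD(3-5)[OF assms e(2)] e(1) by auto
qed

text \<open>Colouring every edge by its type is a colouring without a monochromatic clique on
  \<open>q\<close> vertices.\<close>

lemma shadow_not_arrows:
  assumes G: "typed_graph q r V T" and "q > 0"
  shows "\<not> arrows V (shadow T) (K_vert q) (K_edges q) r"
proof
  assume arr: "arrows V (shadow T) (K_vert q) (K_edges q) r"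
  define c where "c e = (THE s. \<exists>x y. e = {x, y} \<and> T x y = Some s)" for e
  have c: "c {x, y} = s" if "T x y = Some s" for x y s
    unfolding c_def
  proof (rule the_equality)
    show "\<exists>x' y'. {x, y} = {x', y'} \<and> T x' y' = Some s" using that by blast
    show "s' = s" if ex: "\<exists>x' y'. {x, y} = {x', y'} \<and> T x' y' = Some s'" for s'
    proof -
      obtain x' y' where "{x, y} = {x', y'}" "T x' y' = Some s'" using ex by blast
      then show ?thesis
        using \<open>T x y = Some s\<close> typed_graphD(2)[OF G, of x y] by (auto simp: doubleton_eq_iff)
    qed
  qed
  have "\<forall>e\<in>shadow T. c e < r"
    using c typed_graphD(6)[OF G] by (fastforce simp: shadow_def)
  then obtain i where "i < r" "has_copy (K_vert q) (K_edges q) V {e \<in> shadow T. c e = i}"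
    using arr unfolding arrows_def by blast
  then obtain S where S: "S \<subseteq> V" "card S = q" "is_clique {e \<in> shadow T. c e = i} S"
    using has_copy_clique[OF \<open>q > 0\<close>] by blast
  have "type_clique T i S"
    unfolding type_clique_def
  proof (intro ballI impI)
    fix x y assume "x \<in> S" "y \<in> S" "x \<noteq> y"
    then have "{x, y} \<in> shadow T" "c {x, y} = i" using S(3) by (auto simp: is_clique_def)
    then show "T x y = Some i" using c shadow_iff[OF G] by auto
  qed
  then show False using typed_graphD(7)[OF G S(1,2)] by blast
qed

section \<open>Joining new vertices to the sets that may carry the pattern\<close>

lemma s_r_le_pattern_card:
  assumes "r \<ge> 2" "k \<ge> 2" and V: "finite V" and pat: "colour_pattern r V Gs"
    and free: "pattern_H_free r V Gs (K_vert (k+1)) (K_edges (k+1))"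
    and strong: "\<And>c. (\<forall>v\<in>V. c v < r) \<Longrightarrow> strongly_mono_clique r V Gs c k"
  shows "s_r r (K_vert (k+1)) (K_edges (k+1)) \<le> enat (card V)"
proof -
  let ?q = "k + 1" and ?P = "pattern_type r Gs"
  have q: "?q \<ge> 3" "?q \<ge> 2" "?q > 0" using \<open>k \<ge> 2\<close> by auto
  have P: "typed_graph ?q r V ?P" by (rule typed_graph_pattern[OF V pat free q(2)])
  obtain U T where T: "typed_graph ?q r U T" and force:
    "\<forall>\<chi> :: nat set \<Rightarrow> nat. (\<forall>e. \<chi> e < r) \<longrightarrow>
      (\<exists>S\<subseteq>U. card S = ?q \<and> (\<exists>d. \<forall>x\<in>S. \<forall>y\<in>S. x \<noteq> y \<longrightarrow> T x y \<noteq> None \<and> \<chi> {x, y} = d)) \<or>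
      (\<exists>f \<tau>. embeds f V ?P U T \<and> inj_on \<tau> {..<r} \<and> \<tau> ` {..<r} \<subseteq> {..<r} \<and>
        (\<forall>x y s. ?P x y = Some s \<longrightarrow> \<chi> {f x, f y} = \<tau> s))"
    using pattern_forcing[OF P q(1) \<open>r \<ge> 2\<close>] by (elim exE conjE) (rule that)
  have finU: "finite U" by (rule typed_graphD(1)[OF T])
  then obtain M where "\<forall>x\<in>U. x < M" unfolding finite_nat_set_iff_bounded by (rule exE)
  then have M: "x < M" if "x \<in> U" for x using that by (rule bspec)
  define \<W> where "\<W> = {W. W \<subseteq> U \<and> card W = card V}"
  \<comment> \<open>The new vertices lie beyond all of \<open>U\<close>, and
    \<open>set_encode\<close> gives different ones to different finite sets.\<close>
  define h where "h W = M + set_encode W" for W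
  have h_eq: "W = W'" if "h W = h W'" "W \<in> \<W>" "W' \<in> \<W>" for W W'
    using that finU set_encode_eq[of W W'] by (auto simp: h_def \<W>_def finite_subset)
  have h_U: "h W \<notin> U" for W using M[of "h W"] by (auto simp: h_def)
  define V1 where "V1 = U \<union> h ` \<W>"
  define E1 where "E1 = shadow T \<union> {{h W, w} |W w. W \<in> \<W> \<and> w \<in> W}"
  have shadow_U: "e \<subseteq> U" "card e = 2" if "e \<in> shadow T" for e
    using is_graph_shadow[OF T] that by (auto simp: is_graph_def)
  have "finite \<W>" using finU by (simp add: \<W>_def)
  have "is_graph V1 E1"
    unfolding is_graph_def
  proof (intro conjI ballI)
    show "finite V1" using finU \<open>finite \<W>\<close> by (simp add: V1_def)
    fix e assume "e \<in> E1"
    then consider "e \<in> shadow T" | W w where "e = {h W, w}" "W \<in> \<W>" "w \<in> W"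
      by (auto simp: E1_def)
    then have "e \<subseteq> V1 \<and> card e = 2"
    proof cases
      case 1
      then show ?thesis using shadow_U by (auto simp: V1_def)
    next
      case 2
      then have "w \<in> U" by (auto simp: \<W>_def)
      then have "h W \<noteq> w" using h_U by blast
      then show ?thesis using 2 \<open>w \<in> U\<close> by (auto simp: V1_def)
    qed
    then show "e \<subseteq> V1" "card e = 2" by auto
  qed
  moreover have "arrows V1 E1 (K_vert ?q) (K_edges ?q) r"
    unfolding arrows_def
  proof (intro allI impI)
    fix c :: "nat set \<Rightarrow> nat" assume c: "\<forall>e\<in>E1. c e < r"
    \<comment> \<open>\<open>force\<close> speaks of colourings of all sets of naturals, so
      \<open>c\<close> is extended by 0 outside \<open>E1\<close>.\<close>
    define \<chi> where "\<chi> e = (if e \<in> E1 then c e else 0)" for e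
    have \<chi>: "\<forall>e. \<chi> e < r" using c \<open>r \<ge> 2\<close> by (simp add: \<chi>_def)
    have copy: "\<exists>i<r. has_copy (K_vert ?q) (K_edges ?q) V1 {e \<in> E1. c e = i}"
      if S: "S \<subseteq> V1" "card S = ?q" "\<And>x y. x \<in> S \<Longrightarrow> y \<in> S \<Longrightarrow> x \<noteq> y \<Longrightarrow> {x, y} \<in> E1 \<and> \<chi> {x, y} = d"
      for S d
    proof -
      have "is_clique {e \<in> E1. c e = d} S"
        unfolding is_clique_def
      proof (intro ballI impI)
        fix x y assume "x \<in> S" "y \<in> S" "x \<noteq> y"
        then show "{x, y} \<in> {e \<in> E1. c e = d}" using S(3)[of x y] by (auto simp: \<chi>_def)
      qed
      then have "has_copy (K_vert ?q) (K_edges ?q) V1 {e \<in> E1. c e = d}"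
        using S(1,2) has_copy_clique[OF q(3)] by blast
      moreover have "d < r"
      proof -
        have "\<not> is_singleton S" "S \<noteq> {}" using S(2) q by (auto simp: is_singleton_altdef)
        then obtain x y where "x \<in> S" "y \<in> S" "x \<noteq> y" by (metis ex_in_conv is_singletonI')
        then show ?thesis using S(3) \<chi> by metis
      qed
      ultimately show ?thesis by blast
    qed
    from mp[OF spec[OF force, of \<chi>] \<chi>]
    show "\<exists>i<r. has_copy (K_vert ?q) (K_edges ?q) V1 {e \<in> E1. c e = i}"
    proof (elim disjE exE conjE)
      fix S d assume "S \<subseteq> U" "card S = ?q"
        "\<forall>x\<in>S. \<forall>y\<in>S. x \<noteq> y \<longrightarrow> T x y \<noteq> None \<and> \<chi> {x, y} = d"
      then show ?thesis
        using shadow_iff[OF T] by (intro copy[of S d]) (auto simp: V1_def E1_def)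
    next
      fix f \<tau> assume f: "embeds f V ?P U T" and \<tau>: "inj_on \<tau> {..<r}" "\<tau> ` {..<r} \<subseteq> {..<r}"
        and col: "\<forall>x y s. ?P x y = Some s \<longrightarrow> \<chi> {f x, f y} = \<tau> s"
      have inj: "inj_on f V" and fU: "f ` V \<subseteq> U"
        and fT: "\<And>x y s. ?P x y = Some s \<Longrightarrow> T (f x) (f y) = Some s"
        using f by (auto simp: embeds_def)
      have W: "f ` V \<in> \<W>" using fU card_image[OF inj] by (simp add: \<W>_def)
      let ?u = "h (f ` V)"
      \<comment> \<open>An injection of a finite set into itself is a permutation, so each colour at
        the new vertex is the colour of some type.\<close>
      have surj: "\<tau> ` {..<r} = {..<r}" using \<tau> by (simp add: endo_inj_surj)
      \<comment> \<open>colour v by the type whose colour is used on the edge from f v to the new vertex\<close>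
      define c' where "c' v = inv_into {..<r} \<tau> (\<chi> {?u, f v})" for v
      have c': "c' v < r" "\<tau> (c' v) = \<chi> {?u, f v}" for v
      proof -
        have im: "\<chi> {?u, f v} \<in> \<tau> ` {..<r}" using surj \<chi> by simp
        show "c' v < r" using inv_into_into[OF im] by (simp add: c'_def)
        show "\<tau> (c' v) = \<chi> {?u, f v}" unfolding c'_def by (rule f_inv_into_f[OF im])
      qed
      obtain S i where S: "S \<subseteq> V" "card S = k" "i < r" "\<forall>v\<in>S. c' v = i" "is_clique (Gs i) S"
        using strong[of c'] c'(1) unfolding strongly_mono_clique_def by blast
      have finS: "finite S" using S(1) V finite_subset by blast
      have uU: "?u \<notin> U" by (rule h_U)
      have u_edge: "{?u, f v} \<in> E1 \<and> \<chi> {?u, f v} = \<tau> i" if "v \<in> S" for v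
      proof -
        have "f v \<in> f ` V" using that S(1) by blast
        then have "{?u, f v} \<in> E1" using W unfolding E1_def by blast
        then show ?thesis using c'(2)[of v] S(4) that by simp
      qed
      have S_edge: "{f v, f w} \<in> E1 \<and> \<chi> {f v, f w} = \<tau> i" if "v \<in> S" "w \<in> S" "f v \<noteq> f w" for v w
      proof -
        have "{v, w} \<in> Gs i" using that S(5) by (auto simp: is_clique_def)
        then have "?P v w = Some i" using pattern_type_Some[OF pat] S(3) by blast
        then show ?thesis using col fT shadow_iff[OF T] by (simp add: E1_def)
      qed
      show ?thesis
      \<comment> \<open>Edges inside the image of \<open>S\<close> have type \<open>i\<close> and so
        colour \<open>\<tau> i\<close>; the edges to the new vertex have the same colour because
        \<open>c'\<close> is \<open>i\<close> on \<open>S\<close>.\<close>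
      proof (rule copy[of "insert ?u (f ` S)" "\<tau> i"])
        show "insert ?u (f ` S) \<subseteq> V1" using W fU S(1) by (auto simp: V1_def)
        have "?u \<notin> f ` S" using uU fU S(1) by blast
        moreover have "card (f ` S) = k" using card_image[OF inj_on_subset[OF inj S(1)]] S(2) by simp
        ultimately show "card (insert ?u (f ` S)) = ?q" using finS by simp
        fix x y assume "x \<in> insert ?u (f ` S)" "y \<in> insert ?u (f ` S)" "x \<noteq> y"
        then consider v where "x = ?u" "v \<in> S" "y = f v" | v where "y = ?u" "v \<in> S" "x = f v"
          | v w where "v \<in> S" "w \<in> S" "x = f v" "y = f w" by blast
        then show "{x, y} \<in> E1 \<and> \<chi> {x, y} = \<tau> i"
          using u_edge S_edge \<open>x \<noteq> y\<close> by cases (simp_all add: insert_commute)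
      qed
    qed
  qed
  moreover have "{e \<in> E1. e \<subseteq> U} = shadow T"
    using shadow_U h_U by (auto simp: E1_def)
  then have "\<not> arrows U {e \<in> E1. e \<subseteq> U} (K_vert ?q) (K_edges ?q) r"
    using shadow_not_arrows[OF T q(3)] by simp
  moreover have "degree E1 u \<le> card V" if u: "u \<in> V1 - U" for u
  proof -
    obtain W where W: "W \<in> \<W>" "u = h W" using u by (auto simp: V1_def)
    \<comment> \<open>New vertices are not joined to each other, and \<open>h\<close> is injective
      on \<open>\<W>\<close>, so \<open>u\<close> is adjacent only to its own set
      \<open>W\<close>.\<close>
    have "{e \<in> E1. u \<in> e} \<subseteq> (\<lambda>w. {u, w}) ` W"
    proof
      fix e assume "e \<in> {e \<in> E1. u \<in> e}"
      then have e: "e \<in> E1" "u \<in> e" by auto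
      then have "e \<notin> shadow T" using shadow_U u by blast
      then obtain W' w where W': "e = {h W', w}" "W' \<in> \<W>" "w \<in> W'" using e by (auto simp: E1_def)
      then have "w \<noteq> u" using u by (auto simp: \<W>_def)
      then have "h W = h W'" using e W' W by auto
      then have "W' = W" using h_eq W W' by blast
      then show "e \<in> (\<lambda>w. {u, w}) ` W" using W' W by blast
    qed
    moreover have "finite W" using W finU finite_subset by (auto simp: \<W>_def)
    ultimately have "degree E1 u \<le> card W"
      unfolding degree_def by (meson card_image_le card_mono finite_imageI le_trans)
    then show ?thesis using W by (simp add: \<W>_def)
  qed
  ultimately show ?thesis by (rule s_r_le)
qed

theorem theorem2p3:
  fixes r k :: nat
  assumes "r \<ge> 2" and "k \<ge> 2"
  shows "s_r r (K_vert (k+1)) (K_edges (k+1)) \<le> P_r r k"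
  unfolding P_r_def
\<comment> \<open>It suffices to bound \<open>s_r\<close> by the size of every admissible pattern;
  if there is none, the infimum is infinite.\<close>
proof (rule Inf_greatest, clarify)
  fix V Gs assume "finite V" "colour_pattern r V Gs"
    "pattern_H_free r V Gs (K_vert (k+1)) (K_edges (k+1))"
    "\<forall>c. (\<forall>v\<in>V. c v < r) \<longrightarrow> strongly_mono_clique r V Gs c k"
  then show "s_r r (K_vert (k+1)) (K_edges (k+1)) \<le> enat (card V)"
    using s_r_le_pattern_card[OF assms] by blast
qed

end
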